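(* Let $\Omega=(0,1)$, $T>0$, and let $(\rho,u)$ be a smooth solution with $\rho>0$, defined on $[0,T]\times\Omega$, of the initial boundary value problem in the context. Put $G:=\mu(\rho)\partial_xu-p(\rho)$. Then $$\sup_{[0,T]}\|\sqrt t\,\partial_xu(t,\cdot)\|_{L^2}^2+\int_0^T\Big(\|\sqrt t\,\partial_xu(t,\cdot)\|_{L^\infty}^2+\|(\sqrt{\rho\,t}\,\dot u)(t,\cdot)\|_{L^2}^2+\|\sqrt t\,\partial_xG(t,\cdot)\|_{L^2}^2\Big)dt\le C(E_0,\rho^*,\mu_*,\mu^*,T),$$ where $C(\cdots)$ is a constant depending only on the listed quantities (in particular not on a lower bound for $\rho$).
   Context: $\mathbb{R}_+=[0,\infty)$; $\dot u=\partial_tu+u\,\partial_xu$; $\|\cdot\|_{L^q}$ is the $L^q(\Omega)$ norm. Problem: $\partial_t\rho+\partial_x(\rho u)=0$ and $\partial_t(\rho u)+\partial_x(\rho u^2)+\partial_xp(\rho)=\partial_x(\mu(\rho)\partial_xu)$ in $\Omega$, with $(\rho,u)(0,x)=(\rho_0,u_0)(x)$ in $\Omega$ and $u=0$, $p(\rho)-\mu(\rho)\partial_xu=0$ on $\partial\Omega$. Standing assumptions: $p\in C^1(\mathbb{R}_+)$, $p,p'\ge0$, $p$ convex; $\mu\in C^1(\mathbb{R}_+)$, $\mu_*\le\mu\le\mu^*$ for constants $\mu_*,\mu^*>0$, $s\mapsto s\int_1^s\frac{\mu(\bar s)}{\bar s}d\bar s$ convex. The functions $p,\mu$ are given and fixed.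 The initial data satisfy $\int_\Omega\rho_0\,dx=1$, $\int_\Omega\rho_0u_0\,dx=0$, and $\rho_0\le\rho^*$ for a positive constant $\rho^*$. Energy: $e(\rho)=\rho\int_1^\rho\frac{p(s)}{s^2}ds-p(1)(\rho-1)$ and $E_0=\int_\Omega[2e(\rho_0)+\rho_0u_0^2]\,dx$. *)

theory Defs
  imports "HOL-Probability.Essential_Supremum"
begin

text \<open>The spatial domain is \<open>\<Omega> = (0,1)\<close>. Functions on \<open>[0,T] \<times> [0,1]\<close> are curried
  total functions \<open>f t x\<close>; only their values on \<open>[0,T] \<times> [0,1]\<close> are ever used.\<close>

abbreviation \<Omega> :: "real set" where
  "\<Omega> \<equiv> {0<..<1}"

text \<open>Partial derivatives are taken within \<open>[0,T]\<close> and \<open>[0,1]\<close>: they are the usual ones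
  at interior points and one-sided at the end points, so that values of \<open>f\<close> outside
  the domain do not matter.\<close>

definition Dt :: "real \<Rightarrow> (real \<Rightarrow> real \<Rightarrow> real) \<Rightarrow> real \<Rightarrow> real \<Rightarrow> real" where
  "Dt T f t x = vector_derivative (\<lambda>s. f s x) (at t within {0..T})"

definition Dx :: "(real \<Rightarrow> real \<Rightarrow> real) \<Rightarrow> real \<Rightarrow> real \<Rightarrow> real" where
  "Dx f t x = vector_derivative (f t) (at x within {0..1})"

text \<open>\<open>C\<^sup>k\<close> and \<open>C\<^sup>\<infinity>\<close> regularity on \<open>[0,T] \<times> [0,1]\<close>, up to the boundary.\<close>

primrec Ck_on :: "real \<Rightarrow> nat \<Rightarrow> (real \<Rightarrow> real \<Rightarrow> real) \<Rightarrow> bool" where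
  "Ck_on T 0 f \<longleftrightarrow> continuous_on ({0..T} \<times> {0..1}) (\<lambda>(t, x). f t x)"
| "Ck_on T (Suc k) f \<longleftrightarrow>
     continuous_on ({0..T} \<times> {0..1}) (\<lambda>(t, x). f t x) \<and>
     (\<forall>t\<in>{0..T}. \<forall>x\<in>{0..1}.
        (\<lambda>s. f s x) differentiable (at t within {0..T}) \<and>
        f t differentiable (at x within {0..1})) \<and>
     Ck_on T k (Dt T f) \<and> Ck_on T k (Dx f)"

definition smooth_on :: "real \<Rightarrow> (real \<Rightarrow> real \<Rightarrow> real) \<Rightarrow> bool" where
  "smooth_on T f \<longleftrightarrow> (\<forall>k. Ck_on T k f)"

abbreviation deriv_nonneg :: "(real \<Rightarrow> real) \<Rightarrow> real \<Rightarrow> real" where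
  "deriv_nonneg f s \<equiv> vector_derivative f (at s within {0..})"

definition C1_nonneg :: "(real \<Rightarrow> real) \<Rightarrow> bool" where
  "C1_nonneg f \<longleftrightarrow>
     f differentiable_on {0..} \<and> continuous_on {0..} (deriv_nonneg f)"

definition pressure_law :: "(real \<Rightarrow> real) \<Rightarrow> bool" where
  "pressure_law p \<longleftrightarrow>
     C1_nonneg p \<and> (\<forall>s\<ge>0. p s \<ge> 0 \<and> deriv_nonneg p s \<ge> 0) \<and> convex_on {0..} p"

text \<open>The integral \<open>\<integral>\<^sub>1\<^sup>s\<close> is oriented (it is minus the integral over \<open>(s,1)\<close> when \<open>s < 1\<close>).
  Since it diverges at \<open>s = 0\<close>, convexity is stated on \<open>(0,\<infinity>)\<close>; for bounded \<open>\<mu>\<close> the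
  function extends continuously by \<open>0\<close> to \<open>s = 0\<close>, so this amounts to convexity on
  \<open>[0,\<infinity>)\<close>.\<close>

definition viscosity_law :: "(real \<Rightarrow> real) \<Rightarrow> bool" where
  "viscosity_law \<mu> \<longleftrightarrow>
     C1_nonneg \<mu> \<and> convex_on {0<..} (\<lambda>s. s * (LBINT r=ereal 1..ereal s. \<mu> r / r))"

definition internal_energy :: "(real \<Rightarrow> real) \<Rightarrow> real \<Rightarrow> real" where
  "internal_energy p r = r * (LBINT s=ereal 1..ereal r. p s / s\<^sup>2) - p 1 * (r - 1)"

definition energy :: "(real \<Rightarrow> real) \<Rightarrow> (real \<Rightarrow> real) \<Rightarrow> (real \<Rightarrow> real) \<Rightarrow> real" where
  "energy p \<rho>\<^sub>0 u\<^sub>0 =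
     (LINT x:\<Omega>|lborel. 2 * internal_energy p (\<rho>\<^sub>0 x) + \<rho>\<^sub>0 x * (u\<^sub>0 x)\<^sup>2)"

definition flux :: "(real \<Rightarrow> real) \<Rightarrow> (real \<Rightarrow> real) \<Rightarrow> (real \<Rightarrow> real \<Rightarrow> real)
    \<Rightarrow> (real \<Rightarrow> real \<Rightarrow> real) \<Rightarrow> real \<Rightarrow> real \<Rightarrow> real" where
  "flux p \<mu> \<rho> u t x = \<mu> (\<rho> t x) * Dx u t x - p (\<rho> t x)"

definition material_deriv :: "real \<Rightarrow> (real \<Rightarrow> real \<Rightarrow> real) \<Rightarrow> real \<Rightarrow> real \<Rightarrow> real" where
  "material_deriv T u t x = Dt T u t x + u t x * Dx u t x"

definition smooth_solution :: "(real \<Rightarrow> real) \<Rightarrow> (real \<Rightarrow> real) \<Rightarrow> real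
    \<Rightarrow> (real \<Rightarrow> real) \<Rightarrow> (real \<Rightarrow> real)
    \<Rightarrow> (real \<Rightarrow> real \<Rightarrow> real) \<Rightarrow> (real \<Rightarrow> real \<Rightarrow> real) \<Rightarrow> bool" where
  "smooth_solution p \<mu> T \<rho>\<^sub>0 u\<^sub>0 \<rho> u \<longleftrightarrow>
     smooth_on T \<rho> \<and> smooth_on T u \<and>
     (\<forall>t\<in>{0..T}. \<forall>x\<in>\<Omega>.
        Dt T \<rho> t x + Dx (\<lambda>t x. \<rho> t x * u t x) t x = 0 \<and>
        Dt T (\<lambda>t x. \<rho> t x * u t x) t x + Dx (\<lambda>t x. \<rho> t x * (u t x)\<^sup>2) t x
          + Dx (\<lambda>t x. p (\<rho> t x)) t x
        = Dx (\<lambda>t x. \<mu> (\<rho> t x) * Dx u t x) t x) \<and>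
     (\<forall>x\<in>\<Omega>. \<rho> 0 x = \<rho>\<^sub>0 x \<and> u 0 x = u\<^sub>0 x) \<and>
     (\<forall>t\<in>{0..T}. \<forall>x\<in>{0, 1}.
        u t x = 0 \<and> p (\<rho> t x) - \<mu> (\<rho> t x) * Dx u t x = 0)"

text \<open>The \<open>L\<^sup>2(\<Omega>)\<close> and \<open>L\<^sup>\<infinity>(\<Omega>)\<close> norms take values in \<open>[0,\<infinity>]\<close>, so that a bound on them
  includes their finiteness.\<close>

definition L2_norm :: "(real \<Rightarrow> real) \<Rightarrow> ennreal" where
  "L2_norm f =
     (let I = (\<integral>\<^sup>+x\<in>\<Omega>. ennreal ((f x)\<^sup>2) \<partial>lborel)
      in if I = \<infinity> then \<infinity> else ennreal (sqrt (enn2real I)))"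

definition Linf_norm :: "(real \<Rightarrow> real) \<Rightarrow> ennreal" where
  "Linf_norm f = esssup (restrict_space lborel \<Omega>) (\<lambda>x. ennreal \<bar>f x\<bar>)"

end

theory Submission
  imports Defs
begin

text \<open>Write \<open>D\<^sub>t = \<partial>\<^sub>t + u \<partial>\<^sub>x\<close>. The energy identity bounds \<open>\<integral>\<integral> (\<partial>\<^sub>x u)\<^sup>2\<close> by \<open>E\<^sub>0\<close>. Since \<open>\<partial>\<^sub>x G = \<rho> D\<^sub>t u\<close>, the
  function \<open>\<psi>(t,x) = \<integral>\<^sub>0\<^sup>x \<rho> u\<close> satisfies \<open>D\<^sub>t \<psi> = G\<close>, so that \<open>\<integral>\<^sub>1\<^sup>\<rho> \<mu>(s)/s ds + \<psi>\<close> decreases along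
  trajectories; as \<open>\<psi>\<close> is controlled by the energy, \<open>\<rho>\<close> is bounded above.
  Testing the momentum equation with \<open>D\<^sub>t u\<close> gives, for \<open>H = \<integral> (\<mu>(\<rho>) (\<partial>\<^sub>x u)\<^sup>2 / 2 - p(\<rho>) \<partial>\<^sub>x u)\<close>,
  the identity \<open>H' + \<integral> \<rho> (D\<^sub>t u)\<^sup>2 = \<integral> (\<rho> p'(\<rho>) (\<partial>\<^sub>x u)\<^sup>2 - (\<mu>(\<rho>) + \<rho> \<mu>'(\<rho>)) / 2 (\<partial>\<^sub>x u)\<^sup>3)\<close>. Because \<open>G\<close>
  vanishes on the boundary, \<open>\<mu>_lo |\<partial>\<^sub>x u| \<le> |G| + p(\<rho>)\<close> is at most \<open>(M \<integral> \<rho> (D\<^sub>t u)\<^sup>2)\<^sup>1\<^sup>/\<^sup>2 + P\<close> when \<open>\<rho> \<le> M\<close>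
  and \<open>p(\<rho>) \<le> P\<close>; this absorbs the cubic term up to \<open>(\<integral> (\<partial>\<^sub>x u)\<^sup>2)\<^sup>2\<close>, and Gronwall's inequality for \<open>t H\<close> concludes.\<close>

section \<open>Calculus on a space-time rectangle\<close>

text \<open>The weight \<open>t\<close> is there because \<open>E\<^sub>0\<close> gives no control
  of the velocity gradient at time 0. The weighted functional starts from 0, and the unweighted term
  created by differentiating \<open>t\<close> is integrable in time by the energy identity. The
  squared remainder is read as the functional multiplied by the integral of the squared gradient, a
  coefficient that is itself integrable in time by the same identity, so Gronwall costs only a
  factor fixed by the listed quantities. Two features shape the details. Positivity of the density
  is given only in the open interval, so it may vanish at the end points, and arguments there go
  through closure or truncation. And no lower bound on the density may enter: nothing is divided by
  it near vacuum, coefficients are bounded on \<open>[0,M]\<close> including 0, and the square of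
  \<open>G\<^sub>x\<close> is compared with \<open>M\<close> times the density-weighted squared
  acceleration. The bounds on \<open>p\<close>, \<mu> and their derivatives are chosen as functions
  of \<open>M\<close> before any solution is given, which keeps the final constant independent of
  the solution.\<close>

lemma has_real_derivative_within_unique:
  assumes "(f has_real_derivative d) (at x within {a..b})"
    and "(f has_real_derivative e) (at x within {a..b})" "a < b" "x \<in> {a..b}"
  shows "d = e"
  using assms vector_derivative_within_closed_interval
  by (metis has_real_derivative_iff_has_vector_derivative)

lemma has_real_derivative_transform:
  assumes "x \<in> S" "\<And>y. y \<in> S \<Longrightarrow> g y = f y"
    and "(f has_real_derivative d) (at x within S)"
  shows "(g has_real_derivative d) (at x within S)"
  using assms has_vector_derivative_transform
  unfolding has_real_derivative_iff_has_vector_derivative by metis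

lemma Dx_eqI:
  "(f t has_real_derivative d) (at x within {0..1}) \<Longrightarrow> x \<in> {0..1} \<Longrightarrow> Dx f t x = d"
  unfolding Dx_def has_real_derivative_iff_has_vector_derivative
  by (rule vector_derivative_within_closed_interval) auto

lemma Dt_eqI:
  "((\<lambda>s. f s x) has_real_derivative d) (at t within {0..T}) \<Longrightarrow> t \<in> {0..T} \<Longrightarrow> 0 < T
    \<Longrightarrow> Dt T f t x = d"
  unfolding Dt_def has_real_derivative_iff_has_vector_derivative
  by (rule vector_derivative_within_closed_interval) auto

lemma smooth_on_Dt: "smooth_on T f \<Longrightarrow> smooth_on T (Dt T f)"
  and smooth_on_Dx: "smooth_on T f \<Longrightarrow> smooth_on T (Dx f)"
  unfolding smooth_on_def by (metis Ck_on.simps(2))+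

lemma smooth_on_continuous:
  "smooth_on T f \<Longrightarrow> continuous_on ({0..T} \<times> {0..1}) (\<lambda>z. f (fst z) (snd z))"
  unfolding smooth_on_def by (drule spec[of _ 0]) (simp add: split_def)

lemma smooth_on_has_Dt:
  assumes "smooth_on T f" "t \<in> {0..T}" "x \<in> {0..1}"
  shows "((\<lambda>s. f s x) has_real_derivative Dt T f t x) (at t within {0..T})"
proof -
  have "Ck_on T (Suc 0) f"
    using assms(1) unfolding smooth_on_def by blast
  then show ?thesis
    using assms(2,3) unfolding Dt_def has_real_derivative_iff_has_vector_derivative
    by (simp add: vector_derivative_works)
qed

lemma smooth_on_has_Dx:
  assumes "smooth_on T f" "t \<in> {0..T}" "x \<in> {0..1}"
  shows "(f t has_real_derivative Dx f t x) (at x within {0..1})"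
proof -
  have "Ck_on T (Suc 0) f"
    using assms(1) unfolding smooth_on_def by blast
  then show ?thesis
    using assms(2,3) unfolding Dx_def has_real_derivative_iff_has_vector_derivative
    by (simp add: vector_derivative_works)
qed

lemma continuous_on_slice:
  assumes "continuous_on ({0..T} \<times> {0..1}) (\<lambda>z. f (fst z) (snd z))" "t \<in> {0..T}"
  shows "continuous_on {0..1} (f t)"
proof -
  have "continuous_on {0..1} (\<lambda>x. (\<lambda>z. f (fst z) (snd z)) (t, x))"
    by (rule continuous_on_compose2[OF assms(1)]) (use assms(2) in \<open>auto intro!: continuous_intros\<close>)
  then show ?thesis by simp
qed

lemma continuous_on_slice_time:
  assumes "continuous_on ({0..T} \<times> {0..1}) (\<lambda>z. f (fst z) (snd z))" "x \<in> {0..1}"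
  shows "continuous_on {0..T} (\<lambda>t. f t x)"
proof -
  have "continuous_on {0..T} (\<lambda>t. (\<lambda>z. f (fst z) (snd z)) (t, x))"
    by (rule continuous_on_compose2[OF assms(1)]) (use assms(2) in \<open>auto intro!: continuous_intros\<close>)
  then show ?thesis by simp
qed

lemma continuous_on_integral_slice:
  assumes "continuous_on ({0..T} \<times> {0..1}) (\<lambda>z. f (fst z) (snd z))"
  shows "continuous_on {0..T} (\<lambda>t. integral {0..1::real} (f t) :: real)"
  using integral_continuous_on_param[of "{0..T}" 0 1 f] assms by (simp add: split_def)

lemma has_derivative_integral_slice:
  fixes h h' :: "real \<Rightarrow> real \<Rightarrow> real"
  assumes der: "\<And>t x. t \<in> {0..T} \<Longrightarrow> x \<in> {0..1} \<Longrightarrow>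
      ((\<lambda>s. h s x) has_real_derivative h' t x) (at t within {0..T})"
    and cont: "continuous_on ({0..T} \<times> {0..1}) (\<lambda>z. h (fst z) (snd z))"
      "continuous_on ({0..T} \<times> {0..1}) (\<lambda>z. h' (fst z) (snd z))"
    and "t \<in> {0..T}" "b \<le> 1"
  shows "((\<lambda>s. integral {0..b} (h s)) has_real_derivative integral {0..b} (h' t)) (at t within {0..T})"
proof -
  have "((\<lambda>s. integral (cbox 0 b) (h s)) has_real_derivative integral (cbox 0 b) (h' t))
      (at t within {0..T})"
  proof (rule leibniz_rule_field_derivative)
    show "h s integrable_on cbox 0 b" if "s \<in> {0..T}" for s
    proof -
      have "continuous_on {0..b} (h s)"
        by (rule continuous_on_subset[OF continuous_on_slice[OF cont(1) that]]) (use assms in auto)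
      then show ?thesis by (simp add: integrable_continuous_interval)
    qed
    show "continuous_on ({0..T} \<times> cbox 0 b) (\<lambda>(x, t). h' x t)"
      unfolding split_def by (rule continuous_on_subset[OF cont(2)]) (use assms in auto)
  qed (use assms in auto)
  then show ?thesis by simp
qed

lemma integral_Dx:
  fixes f f' :: "real \<Rightarrow> real"
  assumes "0 \<le> b" "b \<le> 1"
    and "\<And>x. x \<in> {0..1} \<Longrightarrow> (f has_real_derivative f' x) (at x within {0..1})"
  shows "integral {0..b} f' = f b - f 0"
proof -
  have "(f' has_integral (f b - f 0)) {0..b}"
  proof (rule fundamental_theorem_of_calculus[OF assms(1)])
    fix x assume "x \<in> {0..b}"
    then have "(f has_real_derivative f' x) (at x within {0..b})"
      using assms by (intro has_field_derivative_subset[OF assms(3)]) auto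
    then show "(f has_vector_derivative f' x) (at x within {0..b})"
      by (simp add: has_real_derivative_iff_has_vector_derivative)
  qed
  then show ?thesis by (rule integral_unique)
qed

text \<open>\<open>smooth_on\<close> asserts existence and continuity of iterated derivatives but
  not their symmetry. Differentiating the fundamental theorem of calculus in \<open>x\<close> under
  the integral sign in time, and then in the upper limit, supplies it.\<close>

lemma Dt_Dx_commute:
  assumes f: "smooth_on T f" and T: "0 < T" and t: "t \<in> {0..T}" and x: "x \<in> {0..1}"
  shows "Dt T (Dx f) t x = Dx (Dt T f) t x"
proof -
  let ?g = "Dt T (Dx f) t"
  have eq: "Dt T f t 0 + integral {0..y} ?g = Dt T f t y" if y: "y \<in> {0..1}" for y
  proof -
    have "((\<lambda>s. integral {0..y} (Dx f s)) has_real_derivative integral {0..y} ?g) (at t within {0..T})"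
      by (rule has_derivative_integral_slice)
        (use f t y in \<open>auto intro: smooth_on_continuous smooth_on_has_Dt smooth_on_Dt smooth_on_Dx\<close>)
    moreover have "integral {0..y} (Dx f s) = f s y - f s 0" if "s \<in> {0..T}" for s
      by (rule integral_Dx) (use y that smooth_on_has_Dx[OF f that] in auto)
    ultimately have "((\<lambda>s. f s y - f s 0) has_real_derivative integral {0..y} ?g) (at t within {0..T})"
      by - (rule has_real_derivative_transform[where f="\<lambda>s. integral {0..y} (Dx f s)"], use t in auto)
    moreover have "((\<lambda>s. f s y - f s 0) has_real_derivative Dt T f t y - Dt T f t 0) (at t within {0..T})"
      using y by (intro derivative_intros smooth_on_has_Dt[OF f t]) auto
    ultimately have "integral {0..y} ?g = Dt T f t y - Dt T f t 0"
      using T t by (rule has_real_derivative_within_unique)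
    then show ?thesis by simp
  qed
  have "continuous_on {0..1} ?g"
    by (rule continuous_on_slice[OF smooth_on_continuous[OF smooth_on_Dt[OF smooth_on_Dx[OF f]]] t])
  then have "((\<lambda>y. Dt T f t 0 + integral {0..y} ?g) has_real_derivative 0 + ?g x) (at x within {0..1})"
    by (intro derivative_intros integral_has_real_derivative x)
  then have "(Dt T f t has_real_derivative ?g x) (at x within {0..1})"
    by - (rule has_real_derivative_transform[where f="\<lambda>y. Dt T f t 0 + integral {0..y} ?g"], use eq x in auto)
  then show ?thesis
    using Dx_eqI x by metis
qed

lemma C1_nonneg_has_derivative:
  assumes "C1_nonneg f" "0 \<le> s"
  shows "(f has_real_derivative deriv_nonneg f s) (at s within {0..})"
proof -
  have "f differentiable (at s within {0..})"
    using assms unfolding C1_nonneg_def differentiable_on_def by auto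
  then show ?thesis
    by (simp add: has_real_derivative_iff_has_vector_derivative vector_derivative_works)
qed

lemma C1_nonneg_continuous: "C1_nonneg f \<Longrightarrow> continuous_on {0..} f"
  unfolding C1_nonneg_def using differentiable_imp_continuous_on by blast

lemma C1_nonneg_chain:
  assumes f: "C1_nonneg f" and g: "(g has_real_derivative d) (at x within S)"
    and nonneg: "\<And>y. y \<in> S \<Longrightarrow> 0 \<le> g y" and x: "x \<in> S"
  shows "((\<lambda>y. f (g y)) has_real_derivative deriv_nonneg f (g x) * d) (at x within S)"
proof -
  have "(f has_real_derivative deriv_nonneg f (g x)) (at (g x) within g ` S)"
    by (rule has_field_derivative_subset[OF C1_nonneg_has_derivative[OF f]]) (use nonneg x in auto)
  from DERIV_image_chain[OF this g] show ?thesis by (simp add: o_def)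
qed

lemma pressure_law_mono:
  assumes "pressure_law p" "0 \<le> a" "a \<le> b"
  shows "p a \<le> p b"
proof (rule DERIV_nonneg_imp_increasing_open[OF assms(3)])
  have C1: "C1_nonneg p" using assms unfolding pressure_law_def by auto
  show "continuous_on {a..b} p"
    by (rule continuous_on_subset[OF C1_nonneg_continuous[OF C1]]) (use assms in auto)
  fix x assume "a < x" "x < b"
  then have "x \<in> interior {0..}" "0 \<le> x"
    using assms by (auto simp: interior_real_atLeast)
  then have "(p has_real_derivative deriv_nonneg p x) (at x)"
    using C1_nonneg_has_derivative[OF C1, of x] at_within_interior[of x "{0..}"] by argo
  moreover have "0 \<le> deriv_nonneg p x"
    using assms(1) \<open>0 \<le> x\<close> unfolding pressure_law_def by blast
  ultimately show "\<exists>y. (p has_real_derivative y) (at x) \<and> 0 \<le> y"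
    by blast
qed

section \<open>The internal energy density and its truncation\<close>

definition pressure_potential :: "(real \<Rightarrow> real) \<Rightarrow> real \<Rightarrow> real" where
  "pressure_potential p r = (LBINT s=ereal 1..ereal r. p s / s\<^sup>2)"

text \<open>This is the derivative of the internal energy density on the positive half-line.\<close>

definition energy_slope :: "(real \<Rightarrow> real) \<Rightarrow> real \<Rightarrow> real" where
  "energy_slope p r = pressure_potential p r + p r / r - p 1"

text \<open>The density may vanish on the boundary, where the energy density need not be differentiable;
  below \<open>\<epsilon>\<close> it is therefore replaced by its tangent at \<open>\<epsilon>\<close>, which lies below it.\<close>

definition truncated_energy :: "(real \<Rightarrow> real) \<Rightarrow> real \<Rightarrow> real \<Rightarrow> real" where
  "truncated_energy p \<epsilon> r =
     (if r \<in> {..<\<epsilon>} then r * energy_slope p \<epsilon> - p \<epsilon> + p 1 else internal_energy p r)"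

lemma pressure_law_continuous: "pressure_law p \<Longrightarrow> continuous_on {0..} p"
  unfolding pressure_law_def using C1_nonneg_continuous by blast

lemma internal_energy_alt: "internal_energy p r = r * pressure_potential p r - p 1 * (r - 1)"
  unfolding internal_energy_def pressure_potential_def ..

lemma DERIV_pressure_potential:
  assumes "pressure_law p" "0 < r"
  shows "(pressure_potential p has_real_derivative p r / r\<^sup>2) (at r)"
proof -
  let ?a = "min 1 r / 2" and ?b = "max 1 r + 1"
  have "continuous_on {?a..?b} (\<lambda>s. p s / s\<^sup>2)"
    using assms by (auto intro!: continuous_intros
      continuous_on_subset[OF pressure_law_continuous[OF assms(1)]])
  then have "((\<lambda>u. LBINT y=ereal 1..ereal u. p y / y\<^sup>2) has_vector_derivative p r / r\<^sup>2)
      (at r within {?a..?b})"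
    by (rule interval_integral_FTC2[rotated 2]) (use assms in auto)
  moreover have "r \<in> interior {?a..?b}"
    using assms by (auto simp: min_def)
  ultimately show ?thesis
    unfolding has_real_derivative_iff_has_vector_derivative pressure_potential_def[abs_def]
    using at_within_interior by metis
qed

text \<open>The map sending \<open>x\<close> to \<open>pressure_potential p x + p a / x\<close> has
  derivative \<open>(p x - p a) / x\<^sup>2\<close>, whose sign is that of \<open>x - a\<close>
  because \<open>p\<close> is nondecreasing; so it is minimal at \<open>a\<close>. Multiplied by
  \<open>r\<close>, this says that the internal energy lies above its tangent at
  \<open>a\<close>.\<close>

lemma pressure_potential_tangent:
  assumes p: "pressure_law p" and "0 < a" "0 < r"
  shows "pressure_potential p a + p a / a \<le> pressure_potential p r + p a / r"
proof -
  have der: "((\<lambda>x. pressure_potential p x + p a / x) has_real_derivative (p x - p a) / x\<^sup>2) (at x)"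
    if "0 < x" for x
  proof -
    have "((\<lambda>x. pressure_potential p x + p a / x) has_real_derivative
        p x / x\<^sup>2 + (0 * x - p a * 1) / (x * x)) (at x)"
      using that by (intro derivative_intros DERIV_pressure_potential[OF p]) auto
    then show ?thesis
      by (simp add: power2_eq_square diff_divide_distrib)
  qed
  show ?thesis
  proof (cases "a \<le> r")
    case True
    then show ?thesis
    proof (rule DERIV_nonneg_imp_nondecreasing)
      fix x assume "a \<le> x" "x \<le> r"
      then have "0 < x" "p a \<le> p x" using assms pressure_law_mono[OF p] by auto
      then show "\<exists>y. ((\<lambda>x. pressure_potential p x + p a / x) has_real_derivative y) (at x) \<and> 0 \<le> y"
        using der[of x] by (intro exI conjI) auto
    qed
  next
    case False
    then have "r \<le> a" by simp
    then show ?thesis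
    proof (rule DERIV_nonpos_imp_nonincreasing)
      fix x assume "r \<le> x" "x \<le> a"
      then have "0 < x" "p x \<le> p a" using assms pressure_law_mono[OF p, of x a] by auto
      then show "\<exists>y. ((\<lambda>x. pressure_potential p x + p a / x) has_real_derivative y) (at x) \<and> y \<le> 0"
        using der[of x] by (intro exI conjI) (auto simp: divide_nonpos_nonneg)
    qed
  qed
qed

lemma pressure_potential_1: "pressure_potential p 1 = 0"
  unfolding pressure_potential_def by simp

lemma DERIV_internal_energy:
  assumes "pressure_law p" "0 < r"
  shows "(internal_energy p has_real_derivative energy_slope p r) (at r)"
proof -
  have "((\<lambda>r. r * pressure_potential p r - p 1 * (r - 1)) has_real_derivative
      (1 * pressure_potential p r + p r / r\<^sup>2 * r) - p 1 * (1 - 0)) (at r)"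
    by (intro derivative_intros DERIV_cmult DERIV_pressure_potential assms)
  moreover have "p r / r\<^sup>2 * r = p r / r"
    using assms by (simp add: power2_eq_square)
  ultimately show ?thesis
    by (simp add: internal_energy_alt[abs_def] energy_slope_def)
qed

text \<open>The tangent at 1 is the zero function: the normalisation with \<open>p 1\<close> makes
  both value and slope vanish there.\<close>

lemma internal_energy_nonneg:
  assumes "pressure_law p" "0 < r"
  shows "0 \<le> internal_energy p r"
proof -
  have "p 1 \<le> pressure_potential p r + p 1 / r"
    using pressure_potential_tangent[OF assms(1), of 1 r] assms pressure_potential_1[of p] by simp
  then have "r * p 1 \<le> r * (pressure_potential p r + p 1 / r)"
    using assms by (intro mult_left_mono) auto
  then show ?thesis
    using assms by (simp add: internal_energy_alt algebra_simps)
qed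

text \<open>The bound is uniform as \<open>r\<close> tends to 0. It makes the initial energy density
  integrable even if the density vanishes at the end points.\<close>

lemma internal_energy_bounded:
  assumes p: "pressure_law p" and r: "0 < r" "r \<le> M"
  shows "internal_energy p r \<le> M * \<bar>pressure_potential p M\<bar> + p 1"
proof -
  have p0: "0 \<le> p r" "0 \<le> p 1"
    using assms unfolding pressure_law_def by auto
  have "p r / M \<le> p r / r"
    using r p0 by (intro divide_left_mono) auto
  then have "pressure_potential p r \<le> pressure_potential p M"
    using pressure_potential_tangent[OF p, of r M] r by simp
  then have "r * pressure_potential p r \<le> r * \<bar>pressure_potential p M\<bar>"
    using r by (intro mult_left_mono) auto
  also have "\<dots> \<le> M * \<bar>pressure_potential p M\<bar>"
    using r by (intro mult_right_mono) auto
  finally show ?thesis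
    using mult_nonneg_nonneg[OF p0(2), of r] r unfolding internal_energy_alt
    by (simp add: algebra_simps)
qed

text \<open>Value and slope of the tangent match those of the internal energy at \<epsilon>, so the
  glued function is differentiable on the whole line and can be composed with the density without a
  positivity condition.\<close>

lemma DERIV_truncated_energy:
  assumes p: "pressure_law p" and \<epsilon>: "0 < \<epsilon>"
  shows "(truncated_energy p \<epsilon> has_real_derivative energy_slope p (max r \<epsilon>)) (at r)"
proof -
  have "((\<lambda>r. if r \<in> {..<\<epsilon>} then r * energy_slope p \<epsilon> - p \<epsilon> + p 1 else internal_energy p r)
    has_vector_derivative (if r \<in> {..<\<epsilon>} then (\<lambda>_. energy_slope p \<epsilon>) r else energy_slope p r))
    (at r within UNIV)"
  proof (rule has_vector_derivative_If_within_closures[where T="{\<epsilon>..}"])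
    show "((\<lambda>r. r * energy_slope p \<epsilon> - p \<epsilon> + p 1) has_vector_derivative energy_slope p \<epsilon>)
      (at r within {..<\<epsilon>} \<union> closure {..<\<epsilon>} \<inter> closure {\<epsilon>..})"
      unfolding has_real_derivative_iff_has_vector_derivative[symmetric]
      by (auto intro!: derivative_eq_intros)
    assume "r \<in> {\<epsilon>..} \<union> closure {..<\<epsilon>} \<inter> closure {\<epsilon>..}"
    then have "0 < r"
      using \<epsilon> by auto
    then show "(internal_energy p has_vector_derivative energy_slope p r)
      (at r within {\<epsilon>..} \<union> closure {..<\<epsilon>} \<inter> closure {\<epsilon>..})"
      unfolding has_real_derivative_iff_has_vector_derivative[symmetric]
      by (rule has_field_derivative_at_within[OF DERIV_internal_energy[OF p]])
  next
    assume "r \<in> closure {..<\<epsilon>}" "r \<in> closure {\<epsilon>..}"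
    then have r: "r = \<epsilon>" by auto
    show "r * energy_slope p \<epsilon> - p \<epsilon> + p 1 = internal_energy p r"
      using \<epsilon> unfolding r energy_slope_def internal_energy_alt by (simp add: field_simps)
    show "energy_slope p \<epsilon> = energy_slope p r"
      by (simp add: r)
  qed auto
  then show ?thesis
    unfolding truncated_energy_def[abs_def] has_real_derivative_iff_has_vector_derivative
    by (cases "r < \<epsilon>") (simp_all add: max_def)
qed

lemma continuous_on_truncated_slope:
  assumes p: "pressure_law p" and \<epsilon>: "0 < \<epsilon>"
  shows "continuous_on UNIV (\<lambda>r. energy_slope p (max r \<epsilon>))"
proof -
  have "continuous_on {0<..} (pressure_potential p)"
    by (rule continuous_at_imp_continuous_on) (auto intro: DERIV_isCont DERIV_pressure_potential p)
  then have "continuous_on {0<..} (energy_slope p)"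
    unfolding energy_slope_def[abs_def]
    by (auto intro!: continuous_intros continuous_on_subset[OF pressure_law_continuous[OF p]])
  then show ?thesis
    by (rule continuous_on_compose2) (use \<epsilon> in \<open>auto intro!: continuous_intros\<close>)
qed

text \<open>For the internal energy \<open>e\<close> one has
  \<open>r e'(r) - e(r) = p(r) - p(1)\<close>; along the tangent the left side keeps its value at
  \<epsilon>. Hence truncation changes the pressure in the energy balance only where the density is
  below \<epsilon>.\<close>

lemma truncated_energy_Legendre:
  assumes "0 < \<epsilon>"
  shows "r * energy_slope p (max r \<epsilon>) - truncated_energy p \<epsilon> r = p (max r \<epsilon>) - p 1"
proof (cases "r < \<epsilon>")
  case False
  then show ?thesis
    using assms unfolding truncated_energy_def energy_slope_def internal_energy_alt
    by (simp add: max_def field_simps)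
qed (simp add: truncated_energy_def)

lemma truncated_energy_le:
  assumes p: "pressure_law p" and "0 < \<epsilon>" "0 < r"
  shows "truncated_energy p \<epsilon> r \<le> internal_energy p r"
proof (cases "r < \<epsilon>")
  case True
  have "r * (pressure_potential p \<epsilon> + p \<epsilon> / \<epsilon>) \<le> r * (pressure_potential p r + p \<epsilon> / r)"
    using assms by (intro mult_left_mono pressure_potential_tangent[OF p]) auto
  then show ?thesis
    using True assms unfolding truncated_energy_def energy_slope_def internal_energy_alt
    by (simp add: algebra_simps)
qed (simp add: truncated_energy_def)

text \<open>For \<epsilon> at most 1 the tangent slope is nonpositive, so to the left of \<epsilon>
  the tangent stays above the value at \<epsilon>, which is nonnegative.\<close>

lemma truncated_energy_nonneg:
  assumes p: "pressure_law p" and \<epsilon>: "0 < \<epsilon>" "\<epsilon> \<le> 1"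
  shows "0 \<le> truncated_energy p \<epsilon> r"
proof (cases "r < \<epsilon>")
  case True
  have "p \<epsilon> \<le> p 1"
    using pressure_law_mono[OF p, of \<epsilon> 1] \<epsilon> by simp
  then have "energy_slope p \<epsilon> \<le> 0"
    using pressure_potential_tangent[OF p, of \<epsilon> 1] \<epsilon> pressure_potential_1[of p]
    unfolding energy_slope_def by simp
  then have "\<epsilon> * energy_slope p \<epsilon> \<le> r * energy_slope p \<epsilon>"
    using True by (intro mult_right_mono_neg) auto
  moreover have "\<epsilon> * energy_slope p \<epsilon> - p \<epsilon> + p 1 = internal_energy p \<epsilon>"
    using \<epsilon> unfolding energy_slope_def internal_energy_alt by (simp add: field_simps)
  ultimately show ?thesis
    using True internal_energy_nonneg[OF p \<epsilon>(1)] unfolding truncated_energy_def by simp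
next
  case False
  then show ?thesis
    using internal_energy_nonneg[OF p] \<epsilon> unfolding truncated_energy_def by simp
qed

section \<open>Smooth solutions up to the boundary\<close>

lemma nonpos_derivative_le_initial:
  fixes f :: "real \<Rightarrow> real"
  assumes der: "\<And>s. s \<in> {0..T} \<Longrightarrow> (f has_real_derivative d s) (at s within {0..T})"
    and nonpos: "\<And>s. s \<in> {0..T} \<Longrightarrow> d s \<le> 0" and t: "t \<in> {0..T}"
  shows "f t \<le> f 0"
proof (rule DERIV_nonpos_imp_decreasing_open[of 0 t f])
  show "0 \<le> t" using t by simp
  have "continuous_on {0..T} f"
    using der DERIV_continuous unfolding continuous_on_eq_continuous_within by blast
  then show "continuous_on {0..t} f"
    by (rule continuous_on_subset) (use t in auto)
  fix s assume s: "0 < s" "s < t"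
  then have "s \<in> interior {0..T}" "s \<in> {0..T}"
    using t by auto
  then have "(f has_real_derivative d s) (at s)"
    using der[of s] at_within_interior[of s "{0..T}"] by simp
  then show "\<exists>y. (f has_real_derivative y) (at s) \<and> y \<le> 0"
    using nonpos[of s] s t by auto
qed

lemma set_lebesgue_integral_unit_interval:
  fixes f :: "real \<Rightarrow> real"
  assumes "continuous_on {0..1} f"
  shows "set_integrable lborel \<Omega> f" "(LINT x:\<Omega>|lborel. f x) = integral {0..1} f"
proof -
  show *: "set_integrable lborel \<Omega> f"
    by (rule set_integrable_subset[OF borel_integrable_atLeastAtMost'[OF assms]]) auto
  show "(LINT x:\<Omega>|lborel. f x) = integral {0..1} f"
    using set_borel_integral_eq_integral(2)[OF *] by (simp add: integral_open_interval_real)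
qed

lemma le_on_unit_interval:
  fixes f :: "real \<Rightarrow> real"
  assumes "continuous_on {0..1} f" "\<And>x. x \<in> \<Omega> \<Longrightarrow> f x \<le> c" "x \<in> {0..1}"
  shows "f x \<le> c"
  using continuous_le_on_closure[of \<Omega> f x c] assms by simp

section \<open>The equations in nonconservative form on the closed interval\<close>

locale viscous_flow =
  fixes p \<mu> :: "real \<Rightarrow> real" and T \<mu>_lo \<mu>_hi \<rho>_hi :: real and \<rho>\<^sub>0 u\<^sub>0 :: "real \<Rightarrow> real"
    and \<rho> u :: "real \<Rightarrow> real \<Rightarrow> real"
  assumes pressure: "pressure_law p" and viscosity: "C1_nonneg \<mu>"
    and lo_pos: "0 < \<mu>_lo" and lo_le: "\<And>s. 0 \<le> s \<Longrightarrow> \<mu>_lo \<le> \<mu> s" and le_hi: "\<And>s. 0 \<le> s \<Longrightarrow> \<mu> s \<le> \<mu>_hi"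
    and initial_density_le: "\<And>x. x \<in> \<Omega> \<Longrightarrow> \<rho>\<^sub>0 x \<le> \<rho>_hi"
    and initial_mass: "(LINT x:\<Omega>|lborel. \<rho>\<^sub>0 x) = 1"
    and T_pos: "0 < T"
    and solution: "smooth_solution p \<mu> T \<rho>\<^sub>0 u\<^sub>0 \<rho> u"
    and density_pos: "\<And>t x. t \<in> {0..T} \<Longrightarrow> x \<in> \<Omega> \<Longrightarrow> 0 < \<rho> t x"
begin

abbreviation "\<rho>\<^sub>t \<equiv> Dt T \<rho>"
abbreviation "\<rho>\<^sub>x \<equiv> Dx \<rho>"
abbreviation "u\<^sub>t \<equiv> Dt T u"
abbreviation "u\<^sub>x \<equiv> Dx u"
abbreviation "u\<^sub>x\<^sub>t \<equiv> Dt T (Dx u)"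
abbreviation "u\<^sub>x\<^sub>x \<equiv> Dx (Dx u)"
abbreviation "G \<equiv> flux p \<mu> \<rho> u"
abbreviation "Q \<equiv> {0..T} \<times> {0..1::real}"

text \<open>With \<open>p\<close> and \<mu> only of class C1, the flux need not be smooth. Its
  spatial derivative is therefore written out by the chain rule, which makes its joint continuity
  visible.\<close>

definition G\<^sub>x :: "real \<Rightarrow> real \<Rightarrow> real" where
  flux_deriv_def: "G\<^sub>x t x = deriv_nonneg \<mu> (\<rho> t x) * \<rho>\<^sub>x t x * u\<^sub>x t x + \<mu> (\<rho> t x) * u\<^sub>x\<^sub>x t x
    - deriv_nonneg p (\<rho> t x) * \<rho>\<^sub>x t x"

lemma smooth_density: "smooth_on T \<rho>" and smooth_velocity: "smooth_on T u"
  using solution unfolding smooth_solution_def by auto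

lemma initial_values: "x \<in> \<Omega> \<Longrightarrow> \<rho> 0 x = \<rho>\<^sub>0 x" "x \<in> \<Omega> \<Longrightarrow> u 0 x = u\<^sub>0 x"
  using solution unfolding smooth_solution_def by auto

lemma boundary_values:
  assumes "t \<in> {0..T}"
  shows "u t 0 = 0" "u t 1 = 0" "G t 0 = 0" "G t 1 = 0"
  using solution assms unfolding smooth_solution_def flux_def by (auto simp: algebra_simps)

lemma pressure_C1: "C1_nonneg p"
  using pressure unfolding pressure_law_def by auto

lemmas continuous_fields =
  smooth_on_continuous[OF smooth_density] smooth_on_continuous[OF smooth_velocity]
  smooth_on_continuous[OF smooth_on_Dt[OF smooth_density]]
  smooth_on_continuous[OF smooth_on_Dx[OF smooth_density]]
  smooth_on_continuous[OF smooth_on_Dt[OF smooth_velocity]]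
  smooth_on_continuous[OF smooth_on_Dx[OF smooth_velocity]]
  smooth_on_continuous[OF smooth_on_Dt[OF smooth_on_Dx[OF smooth_velocity]]]
  smooth_on_continuous[OF smooth_on_Dx[OF smooth_on_Dx[OF smooth_velocity]]]

lemmas has_Dt = smooth_on_has_Dt[OF smooth_density] smooth_on_has_Dt[OF smooth_velocity]
  smooth_on_has_Dt[OF smooth_on_Dx[OF smooth_velocity]]

lemmas has_Dx = smooth_on_has_Dx[OF smooth_density] smooth_on_has_Dx[OF smooth_velocity]
  smooth_on_has_Dx[OF smooth_on_Dx[OF smooth_velocity]]

lemma density_nonneg: "t \<in> {0..T} \<Longrightarrow> x \<in> {0..1} \<Longrightarrow> 0 \<le> \<rho> t x"
  using le_on_unit_interval[of "\<lambda>x. - \<rho> t x" 0 x] density_pos[of t]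
    continuous_on_slice[OF continuous_fields(1), of t]
  by (force intro!: continuous_intros)

lemma continuous_compose_density:
  "continuous_on {0..} f \<Longrightarrow> continuous_on Q (\<lambda>z. f (\<rho> (fst z) (snd z)))"
  by (rule continuous_on_compose2[OF _ continuous_fields(1)]) (auto intro: density_nonneg)

lemma continuous_coefficients:
  "continuous_on Q (\<lambda>z. p (\<rho> (fst z) (snd z)))"
  "continuous_on Q (\<lambda>z. deriv_nonneg p (\<rho> (fst z) (snd z)))"
  "continuous_on Q (\<lambda>z. \<mu> (\<rho> (fst z) (snd z)))"
  "continuous_on Q (\<lambda>z. deriv_nonneg \<mu> (\<rho> (fst z) (snd z)))"
  using viscosity pressure_C1 C1_nonneg_continuous
  by (auto intro!: continuous_compose_density simp: C1_nonneg_def)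

lemma has_derivative_coefficients:
  assumes "t \<in> {0..T}" "x \<in> {0..1}"
  shows "((\<lambda>x. p (\<rho> t x)) has_real_derivative deriv_nonneg p (\<rho> t x) * \<rho>\<^sub>x t x) (at x within {0..1})"
    "((\<lambda>x. \<mu> (\<rho> t x)) has_real_derivative deriv_nonneg \<mu> (\<rho> t x) * \<rho>\<^sub>x t x) (at x within {0..1})"
    "((\<lambda>t. p (\<rho> t x)) has_real_derivative deriv_nonneg p (\<rho> t x) * \<rho>\<^sub>t t x) (at t within {0..T})"
    "((\<lambda>t. \<mu> (\<rho> t x)) has_real_derivative deriv_nonneg \<mu> (\<rho> t x) * \<rho>\<^sub>t t x) (at t within {0..T})"
  using assms by (intro C1_nonneg_chain pressure_C1 viscosity has_Dx has_Dt density_nonneg; auto)+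

lemma continuous_flux:
  "continuous_on Q (\<lambda>z. G (fst z) (snd z))" "continuous_on Q (\<lambda>z. G\<^sub>x (fst z) (snd z))"
  unfolding flux_def flux_deriv_def by (intro continuous_intros continuous_fields continuous_coefficients)+

lemma continuous_material_deriv: "continuous_on Q (\<lambda>z. material_deriv T u (fst z) (snd z))"
  unfolding material_deriv_def by (intro continuous_intros continuous_fields)

lemma flux_has_Dx:
  assumes "t \<in> {0..T}" "x \<in> {0..1}"
  shows "(G t has_real_derivative G\<^sub>x t x) (at x within {0..1})"
proof -
  have "((\<lambda>x. \<mu> (\<rho> t x) * u\<^sub>x t x - p (\<rho> t x)) has_real_derivative
      (deriv_nonneg \<mu> (\<rho> t x) * \<rho>\<^sub>x t x * u\<^sub>x t x + u\<^sub>x\<^sub>x t x * \<mu> (\<rho> t x))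
      - deriv_nonneg p (\<rho> t x) * \<rho>\<^sub>x t x) (at x within {0..1})"
    by (intro derivative_intros has_derivative_coefficients has_Dx assms)
  then show ?thesis
    by (simp add: flux_def[abs_def] flux_deriv_def mult.commute)
qed

lemma continuity_interior:
  assumes "t \<in> {0..T}" "x \<in> \<Omega>"
  shows "\<rho>\<^sub>t t x + (\<rho>\<^sub>x t x * u t x + \<rho> t x * u\<^sub>x t x) = 0"
proof -
  have x: "x \<in> {0..1}" using assms by auto
  have "((\<lambda>x. \<rho> t x * u t x) has_real_derivative \<rho>\<^sub>x t x * u t x + u\<^sub>x t x * \<rho> t x) (at x within {0..1})"
    by (intro derivative_intros has_Dx assms x)
  then have "Dx (\<lambda>t x. \<rho> t x * u t x) t x = \<rho>\<^sub>x t x * u t x + u\<^sub>x t x * \<rho> t x"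
    by (intro Dx_eqI x)
  moreover have "\<rho>\<^sub>t t x + Dx (\<lambda>t x. \<rho> t x * u t x) t x = 0"
    using solution assms unfolding smooth_solution_def by blast
  ultimately show ?thesis
    by (simp add: mult.commute)
qed

text \<open>The equations are given in the open interval only; continuity in \<open>x\<close>
  carries them to the end points, where the maximum principle for the density may have to evaluate
  them.\<close>

lemma continuity:
  assumes "t \<in> {0..T}" "x \<in> {0..1}"
  shows "\<rho>\<^sub>t t x = - (\<rho>\<^sub>x t x * u t x + \<rho> t x * u\<^sub>x t x)"
proof -
  have "\<rho>\<^sub>t t x + (\<rho>\<^sub>x t x * u t x + \<rho> t x * u\<^sub>x t x) = 0"
  proof (rule continuous_constant_on_closure[where S=\<Omega> and f="\<lambda>x. \<rho>\<^sub>t t x + (\<rho>\<^sub>x t x * u t x + \<rho> t x * u\<^sub>x t x)"])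
    show "continuous_on (closure \<Omega>) (\<lambda>x. \<rho>\<^sub>t t x + (\<rho>\<^sub>x t x * u t x + \<rho> t x * u\<^sub>x t x))"
      using assms(1) by (auto intro!: continuous_intros continuous_on_slice[of T] continuous_fields)
  qed (use assms continuity_interior in auto)
  then show ?thesis by simp
qed

text \<open>Subtracting \<open>u\<close> times the continuity equation from the conservative
  momentum equation leaves density times material acceleration on the left.\<close>

lemma momentum_interior:
  assumes "t \<in> {0..T}" "x \<in> \<Omega>"
  shows "G\<^sub>x t x - \<rho> t x * material_deriv T u t x = 0"
proof -
  have x: "x \<in> {0..1}" using assms by auto
  have "((\<lambda>s. \<rho> s x * u s x) has_real_derivative \<rho>\<^sub>t t x * u t x + u\<^sub>t t x * \<rho> t x) (at t within {0..T})"
    by (intro derivative_intros has_Dt assms x)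
  then have 1: "Dt T (\<lambda>t x. \<rho> t x * u t x) t x = \<rho>\<^sub>t t x * u t x + u\<^sub>t t x * \<rho> t x"
    by (intro Dt_eqI assms T_pos)
  have "((\<lambda>x. \<rho> t x * (u t x)\<^sup>2) has_real_derivative
      \<rho>\<^sub>x t x * (u t x)\<^sup>2 + of_nat 2 * (u\<^sub>x t x * u t x ^ (2 - Suc 0)) * \<rho> t x) (at x within {0..1})"
    by (intro derivative_intros has_Dx assms x)
  then have 2: "Dx (\<lambda>t x. \<rho> t x * (u t x)\<^sup>2) t x = \<rho>\<^sub>x t x * (u t x)\<^sup>2 + 2 * (u\<^sub>x t x * u t x) * \<rho> t x"
    using Dx_eqI[of "\<lambda>t x. \<rho> t x * (u t x)\<^sup>2", OF _ x] by simp
  have 3: "Dx (\<lambda>t x. p (\<rho> t x)) t x = deriv_nonneg p (\<rho> t x) * \<rho>\<^sub>x t x"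
    by (intro Dx_eqI has_derivative_coefficients assms x)
  have "((\<lambda>x. \<mu> (\<rho> t x) * u\<^sub>x t x) has_real_derivative
      deriv_nonneg \<mu> (\<rho> t x) * \<rho>\<^sub>x t x * u\<^sub>x t x + u\<^sub>x\<^sub>x t x * \<mu> (\<rho> t x)) (at x within {0..1})"
    by (intro derivative_intros has_derivative_coefficients has_Dx assms x)
  then have 4: "Dx (\<lambda>t x. \<mu> (\<rho> t x) * u\<^sub>x t x) t x
      = deriv_nonneg \<mu> (\<rho> t x) * \<rho>\<^sub>x t x * u\<^sub>x t x + u\<^sub>x\<^sub>x t x * \<mu> (\<rho> t x)"
    by (intro Dx_eqI x)
  have "Dt T (\<lambda>t x. \<rho> t x * u t x) t x + Dx (\<lambda>t x. \<rho> t x * (u t x)\<^sup>2) t x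
      + Dx (\<lambda>t x. p (\<rho> t x)) t x = Dx (\<lambda>t x. \<mu> (\<rho> t x) * u\<^sub>x t x) t x"
    using solution assms unfolding smooth_solution_def by blast
  then show ?thesis
    unfolding 1 2 3 4 flux_deriv_def material_deriv_def continuity[OF assms(1) x]
    by (simp add: algebra_simps power2_eq_square)
qed

lemma momentum:
  assumes "t \<in> {0..T}" "x \<in> {0..1}"
  shows "G\<^sub>x t x = \<rho> t x * material_deriv T u t x"
proof -
  have "G\<^sub>x t x - \<rho> t x * material_deriv T u t x = 0"
  proof (rule continuous_constant_on_closure[where S=\<Omega> and f="\<lambda>x. G\<^sub>x t x - \<rho> t x * material_deriv T u t x"])
    show "continuous_on (closure \<Omega>) (\<lambda>x. G\<^sub>x t x - \<rho> t x * material_deriv T u t x)"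
      using assms(1) by (auto intro!: continuous_intros continuous_on_slice[of T] continuous_fields
          continuous_flux continuous_material_deriv)
  qed (use assms momentum_interior in auto)
  then show ?thesis by simp
qed

lemma integrable_slice:
  fixes f :: "real \<Rightarrow> real \<Rightarrow> real"
  shows "continuous_on Q (\<lambda>z. f (fst z) (snd z)) \<Longrightarrow> t \<in> {0..T} \<Longrightarrow> f t integrable_on {0..1}"
  by (rule integrable_continuous_interval[OF continuous_on_slice])

lemma mass:
  assumes t: "t \<in> {0..T}"
  shows "integral {0..1} (\<rho> t) = 1"
proof -
  have der: "((\<lambda>s. integral {0..1} (\<rho> s)) has_real_derivative 0) (at s within {0..T})"
    if s: "s \<in> {0..T}" for s
  proof -
    have "integral {0..1} (\<rho>\<^sub>t s) = integral {0..1} (\<lambda>x. - (\<rho>\<^sub>x s x * u s x + u\<^sub>x s x * \<rho> s x))"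
      using s by (intro integral_cong) (simp add: continuity mult.commute)
    also have "\<dots> = - (\<rho> s 1 * u s 1) - - (\<rho> s 0 * u s 0)"
      by (rule integral_Dx, simp, simp, intro derivative_intros has_Dx s)
    also have "\<dots> = 0"
      using boundary_values[OF s] by simp
    finally have "integral {0..1} (\<rho>\<^sub>t s) = 0" .
    then show ?thesis
      using has_derivative_integral_slice[of T \<rho> \<rho>\<^sub>t s 1] has_Dt continuous_fields s by simp
  qed
  \<comment> \<open>Constancy follows from monotonicity of the mass and of its negative.\<close>
  have "integral {0..1} (\<rho> t) \<le> integral {0..1} (\<rho> 0)"
    by (rule nonpos_derivative_le_initial[of T "\<lambda>s. integral {0..1} (\<rho> s)" "\<lambda>s. 0"])
      (use der t in auto)
  moreover have "- integral {0..1} (\<rho> t) \<le> - integral {0..1} (\<rho> 0)"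
    by (rule nonpos_derivative_le_initial[of T "\<lambda>s. - integral {0..1} (\<rho> s)" "\<lambda>s. - 0"])
      (intro derivative_intros der, use t in auto)
  moreover have "(LINT x:\<Omega>|lborel. \<rho>\<^sub>0 x) = (LINT x:\<Omega>|lborel. \<rho> 0 x)"
    using initial_values by (intro set_lebesgue_integral_cong) auto
  moreover have "(LINT x:\<Omega>|lborel. \<rho> 0 x) = integral {0..1} (\<rho> 0)"
    using T_pos by (intro set_lebesgue_integral_unit_interval continuous_on_slice[OF continuous_fields(1)]) auto
  ultimately show ?thesis
    using initial_mass by simp
qed

end

section \<open>The energy estimate\<close>

context viscous_flow
begin

lemma bounded_on_rectangle:
  fixes f :: "real \<Rightarrow> real \<Rightarrow> real"
  assumes "continuous_on Q (\<lambda>z. f (fst z) (snd z))"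
  obtains L where "0 \<le> L" "\<And>t x. t \<in> {0..T} \<Longrightarrow> x \<in> {0..1} \<Longrightarrow> \<bar>f t x\<bar> \<le> L"
proof -
  have "compact ((\<lambda>z. f (fst z) (snd z)) ` Q)"
    by (intro compact_continuous_image assms compact_Times compact_Icc)
  then obtain L where L: "\<forall>y\<in>(\<lambda>z. f (fst z) (snd z)) ` Q. norm y \<le> L"
    using compact_imp_bounded bounded_iff by metis
  have "\<bar>f t x\<bar> \<le> L" if "t \<in> {0..T}" "x \<in> {0..1}" for t x
    using L that by force
  then show ?thesis
    using that[of "max L 0"] by fastforce
qed

text \<open>Exact balance for the truncated energy: besides the dissipation it contains only the
  defect \<open>p (\<rho> t x) - p (max (\<rho> t x) \<epsilon>)\<close>, which vanishes where the
  density is at least \<epsilon>.\<close>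

lemma has_derivative_energy:
  assumes \<epsilon>: "0 < \<epsilon>" and t: "t \<in> {0..T}"
  shows "((\<lambda>s. integral {0..1} (\<lambda>x. \<rho> s x * (u s x)\<^sup>2 / 2 + truncated_energy p \<epsilon> (\<rho> s x)))
    has_real_derivative integral {0..1} (\<lambda>x. (p (\<rho> t x) - p (max (\<rho> t x) \<epsilon>)) * u\<^sub>x t x
      - \<mu> (\<rho> t x) * (u\<^sub>x t x)\<^sup>2)) (at t within {0..T})"
proof -
  define h' where "h' s x = (\<rho>\<^sub>t s x * (u s x)\<^sup>2 + of_nat 2 * (u\<^sub>t s x * u s x ^ (2 - Suc 0)) * \<rho> s x) / 2
    + energy_slope p (max (\<rho> s x) \<epsilon>) * \<rho>\<^sub>t s x" for s x
  define d where "d x = (p (\<rho> t x) - p (max (\<rho> t x) \<epsilon>)) * u\<^sub>x t x - \<mu> (\<rho> t x) * (u\<^sub>x t x)\<^sup>2" for x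
  \<comment> \<open>The divergence part: the \<open>x\<close>-derivative of
    \<open>G u - \<rho> u^3 / 2 - e u + p(1) u\<close>, with \<open>e\<close> the truncated energy.
    Every term carries a factor \<open>u\<close>, so its integral is 0. The summand with
    \<open>p 1\<close> compensates the constant in the Legendre identity.\<close>
  define K' where "K' x = ((G\<^sub>x t x * u t x + u\<^sub>x t x * G t x)
      - (\<rho>\<^sub>x t x * u t x ^ 3 + of_nat 3 * (u\<^sub>x t x * u t x ^ (3 - Suc 0)) * \<rho> t x) / 2)
      - (energy_slope p (max (\<rho> t x) \<epsilon>) * \<rho>\<^sub>x t x * u t x + u\<^sub>x t x * truncated_energy p \<epsilon> (\<rho> t x))
      + p 1 * u\<^sub>x t x" for x
  note tr = DERIV_chain2[OF DERIV_truncated_energy[OF pressure \<epsilon>]]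
  have ctr: "continuous_on Q (\<lambda>z. truncated_energy p \<epsilon> (\<rho> (fst z) (snd z)))"
    by (rule continuous_on_compose2[OF _ continuous_fields(1)])
      (auto intro!: continuous_at_imp_continuous_on DERIV_isCont DERIV_truncated_energy pressure \<epsilon>)
  have csl: "continuous_on Q (\<lambda>z. energy_slope p (max (\<rho> (fst z) (snd z)) \<epsilon>))"
    by (rule continuous_on_compose2[OF continuous_on_truncated_slope[OF pressure \<epsilon>] continuous_fields(1)]) auto
  have cd: "continuous_on {0..1} d"
  proof -
    have "continuous_on {0..} (\<lambda>r. p (max r \<epsilon>))"
      using \<epsilon> by (intro continuous_on_compose2[OF pressure_law_continuous[OF pressure]] continuous_intros) auto
    from continuous_compose_density[OF this] show ?thesis unfolding d_def
      by (intro continuous_intros continuous_on_slice[OF _ t] continuous_fields continuous_coefficients)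
  qed
  have "((\<lambda>s. integral {0..1} (\<lambda>x. \<rho> s x * (u s x)\<^sup>2 / 2 + truncated_energy p \<epsilon> (\<rho> s x)))
      has_real_derivative integral {0..1} (h' t)) (at t within {0..T})"
  proof (rule has_derivative_integral_slice)
    show "((\<lambda>s. \<rho> s x * (u s x)\<^sup>2 / 2 + truncated_energy p \<epsilon> (\<rho> s x)) has_real_derivative h' s x)
        (at s within {0..T})" if "s \<in> {0..T}" "x \<in> {0..1}" for s x
      unfolding h'_def by (intro derivative_intros DERIV_cdivide tr has_Dt that)
  qed (use t in \<open>auto simp: h'_def intro!: continuous_intros continuous_fields ctr csl\<close>)
  moreover have "h' t x = K' x + d x" if x: "x \<in> {0..1}" for x
  proof -
    have slope: "truncated_energy p \<epsilon> (\<rho> t x) = \<rho> t x * energy_slope p (max (\<rho> t x) \<epsilon>) - p (max (\<rho> t x) \<epsilon>) + p 1"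
      using truncated_energy_Legendre[OF \<epsilon>, of "\<rho> t x" p] by simp
    show ?thesis
      unfolding h'_def K'_def d_def slope continuity[OF t x] momentum[OF t x] material_deriv_def flux_def
      by (simp add: field_simps power2_eq_square power3_eq_cube)
  qed
  then have "integral {0..1} (h' t) = integral {0..1} (\<lambda>x. K' x + d x)"
    by (intro integral_cong)
  moreover have "integral {0..1} (\<lambda>x. K' x + d x) = integral {0..1} K' + integral {0..1} d"
  proof (rule integral_add)
    show "d integrable_on {0..1}"
      using cd by (rule integrable_continuous_interval)
    have "continuous_on {0..1} K'" unfolding K'_def
      by (intro continuous_intros continuous_on_slice[OF _ t] continuous_fields continuous_coefficients
          continuous_flux ctr csl; simp)
    then show "K' integrable_on {0..1}"
      by (rule integrable_continuous_interval)
  qed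
  moreover have "integral {0..1} K' = 0"
  proof -
    let ?K = "\<lambda>x. G t x * u t x - \<rho> t x * u t x ^ 3 / 2 - truncated_energy p \<epsilon> (\<rho> t x) * u t x + p 1 * u t x"
    have "integral {0..1} K' = ?K 1 - ?K 0"
      unfolding K'_def by (rule integral_Dx, simp, simp,
          intro derivative_intros DERIV_cdivide tr DERIV_cmult has_Dx[OF t] flux_has_Dx[OF t])
    then show ?thesis
      using boundary_values[OF t] by simp
  qed
  ultimately show ?thesis
    by (simp add: d_def[abs_def])
qed

definition gradient_sq :: "real \<Rightarrow> real" where
  "gradient_sq t = integral {0..1} (\<lambda>x. (u\<^sub>x t x)\<^sup>2)"

lemma continuous_gradient_sq: "continuous_on {0..T} gradient_sq"
  unfolding gradient_sq_def[abs_def]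
  by (rule continuous_on_integral_slice) (intro continuous_intros continuous_fields)

lemma gradient_sq_nonneg: "t \<in> {0..T} \<Longrightarrow> 0 \<le> gradient_sq t"
  unfolding gradient_sq_def
  by (rule integral_nonneg) (auto intro!: integrable_slice continuous_intros continuous_fields)

text \<open>An inequality suffices, since the truncated density lies below the internal
  energy.\<close>

lemma initial_energy:
  assumes \<epsilon>: "0 < \<epsilon>"
  shows "2 * integral {0..1} (\<lambda>x. \<rho> 0 x * (u 0 x)\<^sup>2 / 2 + truncated_energy p \<epsilon> (\<rho> 0 x))
    \<le> energy p \<rho>\<^sub>0 u\<^sub>0"
proof -
  let ?g = "\<lambda>x. 2 * truncated_energy p \<epsilon> (\<rho> 0 x) + \<rho> 0 x * (u 0 x)\<^sup>2"
  let ?e = "\<lambda>x. 2 * internal_energy p (\<rho> 0 x) + \<rho> 0 x * (u 0 x)\<^sup>2"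
  have T0: "0 \<in> {0..T}" using T_pos by simp
  note c = continuous_on_slice[OF continuous_fields(1) T0] continuous_on_slice[OF continuous_fields(2) T0]
  have g: "continuous_on {0..1} ?g"
    by (intro continuous_intros c continuous_on_compose2[OF _ c(1), of UNIV])
      (auto intro!: continuous_at_imp_continuous_on DERIV_isCont DERIV_truncated_energy pressure \<epsilon>)
  have "continuous_on {0<..} (internal_energy p)"
    by (rule continuous_at_imp_continuous_on) (auto intro: DERIV_isCont DERIV_internal_energy pressure)
  then have "continuous_on \<Omega> (\<lambda>x. internal_energy p (\<rho> 0 x))"
    by (rule continuous_on_compose2) (use density_pos[OF T0] in \<open>auto intro: continuous_on_subset[OF c(1)]\<close>)
  then have "continuous_on \<Omega> ?e"
    by (intro continuous_intros continuous_on_subset[OF c(1)] continuous_on_subset[OF c(2)]) auto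
  then have meas: "(\<lambda>x. indicator \<Omega> x *\<^sub>R ?e x) \<in> borel_measurable borel"
    by (intro borel_measurable_continuous_on_indicator) auto
  obtain L where L: "\<And>t x. t \<in> {0..T} \<Longrightarrow> x \<in> {0..1} \<Longrightarrow> \<bar>\<rho> t x\<bar> \<le> L"
    using bounded_on_rectangle[OF continuous_fields(1)] by metis
  obtain K where K: "\<And>t x. t \<in> {0..T} \<Longrightarrow> x \<in> {0..1} \<Longrightarrow> \<bar>\<rho> t x * (u t x)\<^sup>2\<bar> \<le> K"
  proof (rule bounded_on_rectangle)
    show "continuous_on Q (\<lambda>z. \<rho> (fst z) (snd z) * (u (fst z) (snd z))\<^sup>2)"
      by (intro continuous_intros continuous_fields)
  qed blast
  define B where "B = 2 * (L * \<bar>pressure_potential p L\<bar> + p 1) + K"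
  have bound: "norm (?e x) \<le> B" if "x \<in> \<Omega>" for x
  proof -
    have r: "0 < \<rho> 0 x" using density_pos[OF T0 that] .
    have "\<rho> 0 x \<le> L" "\<bar>\<rho> 0 x * (u 0 x)\<^sup>2\<bar> \<le> K" using L[OF T0, of x] K[OF T0, of x] that by auto
    then show ?thesis
      using internal_energy_bounded[OF pressure r, of L] internal_energy_nonneg[OF pressure r]
      unfolding B_def by simp
  qed
  \<comment> \<open>Integrability is essential here: a nonintegrable density would have integral 0
    by convention and the comparison would break down.\<close>
  have int: "set_integrable lborel \<Omega> ?e"
    unfolding set_integrable_def
    by (rule integrableI_bounded_set[where A=\<Omega> and B=B]) (use meas bound in auto)
  have "2 * integral {0..1} (\<lambda>x. \<rho> 0 x * (u 0 x)\<^sup>2 / 2 + truncated_energy p \<epsilon> (\<rho> 0 x)) = integral {0..1} ?g"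
    by (subst integral_mult_right[symmetric]) (simp add: algebra_simps)
  also have "\<dots> = (LINT x:\<Omega>|lborel. ?g x)"
    using set_lebesgue_integral_unit_interval(2)[OF g] by simp
  also have "\<dots> \<le> (LINT x:\<Omega>|lborel. ?e x)"
    by (rule set_integral_mono[OF set_lebesgue_integral_unit_interval(1)[OF g] int])
      (use truncated_energy_le[OF pressure \<epsilon>] density_pos[OF T0] in auto)
  also have "\<dots> = energy p \<rho>\<^sub>0 u\<^sub>0"
    unfolding energy_def using initial_values by (intro set_lebesgue_integral_cong) auto
  finally show ?thesis .
qed

text \<open>The truncated balance holds with an error caused by the pressure defect; the estimate
  without error is its limit as \<epsilon> tends to 0, by continuity of \<open>p\<close> at
  0.\<close>

lemma energy_estimate:
  assumes t: "t \<in> {0..T}"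
  shows "integral {0..1} (\<lambda>x. \<rho> t x * (u t x)\<^sup>2) + 2 * \<mu>_lo * integral {0..t} gradient_sq
    \<le> energy p \<rho>\<^sub>0 u\<^sub>0"
proof -
  obtain L where L: "0 \<le> L" "\<And>t x. t \<in> {0..T} \<Longrightarrow> x \<in> {0..1} \<Longrightarrow> \<bar>u\<^sub>x t x\<bar> \<le> L"
    using bounded_on_rectangle[OF continuous_fields(6)] by metis
  define K where "K = integral {0..1} (\<lambda>x. \<rho> t x * (u t x)\<^sup>2)"
  define W where "W t = integral {0..t} gradient_sq" for t
  have W: "(W has_real_derivative gradient_sq s) (at s within {0..T})" if "s \<in> {0..T}" for s
    unfolding W_def[abs_def] using integral_has_real_derivative[OF continuous_gradient_sq that] .
  \<comment> \<open>The constant \<open>L\<close> bounds the velocity gradient of this particular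
    solution. It may enter because its coefficient \<open>p \<epsilon> - p 0\<close> tends to
    0.\<close>
  have main: "K + 2 * \<mu>_lo * W t \<le> energy p \<rho>\<^sub>0 u\<^sub>0 + 2 * ((p \<epsilon> - p 0) * L * t)" if \<epsilon>: "0 < \<epsilon>" "\<epsilon> \<le> 1" for \<epsilon>
  proof -
    define A where "A s = integral {0..1} (\<lambda>x. \<rho> s x * (u s x)\<^sup>2 / 2 + truncated_energy p \<epsilon> (\<rho> s x))" for s
    define d where "d s x = (p (\<rho> s x) - p (max (\<rho> s x) \<epsilon>)) * u\<^sub>x s x - \<mu> (\<rho> s x) * (u\<^sub>x s x)\<^sup>2" for s x
    have "(\<lambda>s. A s + \<mu>_lo * W s - (p \<epsilon> - p 0) * L * s) t \<le> (\<lambda>s. A s + \<mu>_lo * W s - (p \<epsilon> - p 0) * L * s) 0"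
    proof (rule nonpos_derivative_le_initial[OF _ _ t])
      fix s assume s: "s \<in> {0..T}"
      show "((\<lambda>s. A s + \<mu>_lo * W s - (p \<epsilon> - p 0) * L * s) has_real_derivative
          integral {0..1} (d s) + \<mu>_lo * gradient_sq s - (p \<epsilon> - p 0) * L * 1) (at s within {0..T})"
        unfolding A_def[abs_def] d_def
        by (intro derivative_intros DERIV_cmult has_derivative_energy[OF \<epsilon>(1) s] W s)
      have le: "d s x \<le> (p \<epsilon> - p 0) * L - \<mu>_lo * (u\<^sub>x s x)\<^sup>2" if x: "x \<in> {0..1}" for x
      proof -
        note r = density_nonneg[OF s x]
        have "p 0 \<le> p \<epsilon>" "p 0 \<le> p (\<rho> s x)" using pressure_law_mono[OF pressure] \<epsilon> r by auto
        then have "\<bar>p (\<rho> s x) - p (max (\<rho> s x) \<epsilon>)\<bar> \<le> p \<epsilon> - p 0"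
          using pressure_law_mono[OF pressure r, of \<epsilon>] by (auto simp: max_def)
        then have "\<bar>p (\<rho> s x) - p (max (\<rho> s x) \<epsilon>)\<bar> * \<bar>u\<^sub>x s x\<bar> \<le> (p \<epsilon> - p 0) * L"
          by (rule mult_mono) (use L(2)[OF s x] \<open>p 0 \<le> p \<epsilon>\<close> in auto)
        then have "(p (\<rho> s x) - p (max (\<rho> s x) \<epsilon>)) * u\<^sub>x s x \<le> (p \<epsilon> - p 0) * L"
          by (metis abs_le_iff abs_mult dual_order.trans order_refl)
        moreover have "\<mu>_lo * (u\<^sub>x s x)\<^sup>2 \<le> \<mu> (\<rho> s x) * (u\<^sub>x s x)\<^sup>2"
          using lo_le[OF r] by (intro mult_right_mono) auto
        ultimately show ?thesis unfolding d_def by simp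
      qed
      have cd: "continuous_on {0..1} (d s)"
      proof -
        have "continuous_on {0..} (\<lambda>r. p (max r \<epsilon>))"
          using \<epsilon> by (intro continuous_on_compose2[OF pressure_law_continuous[OF pressure]] continuous_intros) auto
        from continuous_compose_density[OF this] show ?thesis unfolding d_def
          by (intro continuous_intros continuous_on_slice[OF _ s] continuous_fields continuous_coefficients)
      qed
      have int: "(\<lambda>x. (u\<^sub>x s x)\<^sup>2) integrable_on {0..1}"
        by (intro integrable_continuous_interval continuous_intros continuous_on_slice[OF _ s] continuous_fields)
      have "integral {0..1} (d s) \<le> integral {0..1} (\<lambda>x. (p \<epsilon> - p 0) * L - \<mu>_lo * (u\<^sub>x s x)\<^sup>2)"
        by (rule integral_le[OF integrable_continuous_interval[OF cd] _ le])
          (intro integrable_continuous_interval continuous_intros continuous_on_slice[OF _ s] continuous_fields)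
      also have "\<dots> = (p \<epsilon> - p 0) * L - \<mu>_lo * gradient_sq s"
        unfolding gradient_sq_def using integrable_cmul[OF int, of \<mu>_lo]
        by (subst integral_diff) auto
      finally show "integral {0..1} (d s) + \<mu>_lo * gradient_sq s - (p \<epsilon> - p 0) * L * 1 \<le> 0"
        by simp
    qed
    moreover have "2 * A 0 \<le> energy p \<rho>\<^sub>0 u\<^sub>0"
      using initial_energy[OF \<epsilon>(1)] unfolding A_def .
    moreover have "K / 2 \<le> A t"
    proof -
      have ctr: "continuous_on Q (\<lambda>z. truncated_energy p \<epsilon> (\<rho> (fst z) (snd z)))"
        by (rule continuous_on_compose2[OF _ continuous_fields(1), of UNIV])
          (auto intro!: continuous_at_imp_continuous_on DERIV_isCont DERIV_truncated_energy pressure \<epsilon>)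
      have "integral {0..1} (\<lambda>x. \<rho> t x * (u t x)\<^sup>2 / 2) \<le> A t"
        unfolding A_def using truncated_energy_nonneg[OF pressure \<epsilon>]
        by (intro integral_le integrable_continuous_interval continuous_intros
            continuous_on_slice[OF _ t] continuous_fields ctr) auto
      then show ?thesis unfolding K_def by simp
    qed
    moreover have "W 0 = 0" unfolding W_def by simp
    ultimately show ?thesis by simp
  qed
  have "(p \<longlongrightarrow> p 0) (at 0 within {0..})"
    using pressure_law_continuous[OF pressure] by (simp add: continuous_on_def)
  then have p0: "(p \<longlongrightarrow> p 0) (at_right 0)"
    by (rule tendsto_within_subset) auto
  have "((\<lambda>\<epsilon>. energy p \<rho>\<^sub>0 u\<^sub>0 + 2 * ((p \<epsilon> - p 0) * L * t)) \<longlongrightarrow> energy p \<rho>\<^sub>0 u\<^sub>0 + 2 * ((p 0 - p 0) * L * t)) (at_right 0)"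
    by (intro tendsto_intros p0)
  moreover have "\<forall>\<^sub>F \<epsilon> in at_right 0. K + 2 * \<mu>_lo * W t \<le> energy p \<rho>\<^sub>0 u\<^sub>0 + 2 * ((p \<epsilon> - p 0) * L * t)"
    unfolding eventually_at_right_field using main by (intro exI[of _ 1]) auto
  ultimately have "K + 2 * \<mu>_lo * W t \<le> energy p \<rho>\<^sub>0 u\<^sub>0 + 2 * ((p 0 - p 0) * L * t)"
    by (rule tendsto_lowerbound) simp
  then show ?thesis unfolding K_def W_def by simp
qed

end

section \<open>The upper bound for the density\<close>

text \<open>Separate continuity becomes joint continuity when one variable is controlled uniformly
  in the other. This serves the momentum potential, which is an integral with variable upper
  limit.\<close>

lemma continuous_on_Times_Lipschitz:
  fixes f :: "real \<Rightarrow> real \<Rightarrow> real"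
  assumes cont: "\<And>x. x \<in> B \<Longrightarrow> continuous_on A (\<lambda>t. f t x)"
    and Lip: "\<And>t x y. t \<in> A \<Longrightarrow> x \<in> B \<Longrightarrow> y \<in> B \<Longrightarrow> \<bar>f t x - f t y\<bar> \<le> C * \<bar>x - y\<bar>"
  shows "continuous_on (A \<times> B) (\<lambda>z. f (fst z) (snd z))"
  unfolding continuous_on_def
proof
  fix z assume z: "z \<in> A \<times> B"
  have "continuous_on (A \<times> B) (\<lambda>w. f (fst w) (snd z))"
    by (rule continuous_on_compose2[OF cont]) (use z in \<open>auto intro: continuous_intros\<close>)
  then have 1: "((\<lambda>w. f (fst w) (snd z)) \<longlongrightarrow> f (fst z) (snd z)) (at z within A \<times> B)"
    using z unfolding continuous_on_def by blast
  have "((\<lambda>w. C * \<bar>snd w - snd z\<bar>) \<longlongrightarrow> C * \<bar>snd z - snd z\<bar>) (at z within A \<times> B)"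
    by (intro tendsto_intros)
  then have "((\<lambda>w. C * \<bar>snd w - snd z\<bar>) \<longlongrightarrow> 0) (at z within A \<times> B)"
    by simp
  moreover have "\<forall>\<^sub>F w in at z within A \<times> B.
      norm (f (fst w) (snd w) - f (fst w) (snd z)) \<le> C * \<bar>snd w - snd z\<bar>"
    unfolding eventually_at_filter using Lip z by (auto intro!: always_eventually)
  ultimately have "((\<lambda>w. f (fst w) (snd w) - f (fst w) (snd z)) \<longlongrightarrow> 0) (at z within A \<times> B)"
    by (rule Lim_null_comparison[rotated])
  from tendsto_add[OF 1 this]
  show "((\<lambda>z. f (fst z) (snd z)) \<longlongrightarrow> f (fst z) (snd z)) (at z within A \<times> B)"
    by simp
qed

section \<open>Momentum potential and logarithmic viscosity\<close>

context viscous_flow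
begin

abbreviation "E\<^sub>0 \<equiv> energy p \<rho>\<^sub>0 u\<^sub>0"

definition momentum_potential :: "real \<Rightarrow> real \<Rightarrow> real" where
  "momentum_potential t x = integral {0..x} (\<lambda>y. \<rho> t y * u t y)"

text \<open>For \<open>r < 1\<close> the interval is empty and the value is 0 rather than the
  oriented integral; the estimates below concern \<open>1 \<le> r\<close>, where both agree.\<close>

definition log_viscosity :: "real \<Rightarrow> real" where
  "log_viscosity r = integral {1..r} (\<lambda>s. \<mu> s / s)"

lemma momentum_potential_Dx:
  assumes "t \<in> {0..T}" "x \<in> {0..1}"
  shows "(momentum_potential t has_real_derivative \<rho> t x * u t x) (at x within {0..1})"
  unfolding momentum_potential_def[abs_def]
  by (rule integral_has_real_derivative[OF _ assms(2)])
    (intro continuous_intros continuous_on_slice[OF _ assms(1)] continuous_fields)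

text \<open>In conservative form the time derivative of the momentum is the
  \<open>x\<close>-derivative of \<open>G - \<rho> u^2\<close>. Integration from 0 leaves no
  contribution of the lower end, where both \<open>G\<close> and \<open>u\<close> vanish.\<close>

lemma momentum_potential_Dt:
  assumes t: "t \<in> {0..T}" and x: "x \<in> {0..1}"
  shows "((\<lambda>s. momentum_potential s x) has_real_derivative G t x - \<rho> t x * (u t x)\<^sup>2) (at t within {0..T})"
proof -
  have "((\<lambda>s. momentum_potential s x) has_real_derivative
      integral {0..x} (\<lambda>y. \<rho>\<^sub>t t y * u t y + u\<^sub>t t y * \<rho> t y)) (at t within {0..T})"
    unfolding momentum_potential_def
  proof (rule has_derivative_integral_slice)
    show "((\<lambda>s. \<rho> s y * u s y) has_real_derivative \<rho>\<^sub>t s y * u s y + u\<^sub>t s y * \<rho> s y) (at s within {0..T})"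
      if "s \<in> {0..T}" "y \<in> {0..1}" for s y
      by (intro derivative_intros has_Dt that)
  qed (use t x in \<open>auto intro!: continuous_intros continuous_fields\<close>)
  moreover have "integral {0..x} (\<lambda>y. \<rho>\<^sub>t t y * u t y + u\<^sub>t t y * \<rho> t y)
    = integral {0..x} (\<lambda>y. G\<^sub>x t y - (\<rho>\<^sub>x t y * (u t y)\<^sup>2 + of_nat 2 * (u\<^sub>x t y * u t y ^ (2 - Suc 0)) * \<rho> t y))"
  proof (rule integral_cong)
    fix y assume "y \<in> {0..x}"
    then have y: "y \<in> {0..1}" using x by auto
    show "\<rho>\<^sub>t t y * u t y + u\<^sub>t t y * \<rho> t y
        = G\<^sub>x t y - (\<rho>\<^sub>x t y * (u t y)\<^sup>2 + of_nat 2 * (u\<^sub>x t y * u t y ^ (2 - Suc 0)) * \<rho> t y)"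
      unfolding continuity[OF t y] momentum[OF t y] material_deriv_def
      by (simp add: algebra_simps power2_eq_square)
  qed
  moreover have "integral {0..x} (\<lambda>y. G\<^sub>x t y - (\<rho>\<^sub>x t y * (u t y)\<^sup>2 + of_nat 2 * (u\<^sub>x t y * u t y ^ (2 - Suc 0)) * \<rho> t y))
    = (G t x - \<rho> t x * (u t x)\<^sup>2) - (G t 0 - \<rho> t 0 * (u t 0)\<^sup>2)"
    by (rule integral_Dx) (use x in simp, use x in simp, intro derivative_intros has_Dx[OF t] flux_has_Dx[OF t])
  ultimately show ?thesis
    using boundary_values[OF t] by simp
qed

lemma continuous_momentum_potential: "continuous_on Q (\<lambda>z. momentum_potential (fst z) (snd z))"
proof -
  obtain L where L: "\<And>t x. t \<in> {0..T} \<Longrightarrow> x \<in> {0..1} \<Longrightarrow> \<bar>\<rho> t x * u t x\<bar> \<le> L"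
  proof (rule bounded_on_rectangle)
    show "continuous_on Q (\<lambda>z. \<rho> (fst z) (snd z) * u (fst z) (snd z))"
      by (intro continuous_intros continuous_fields)
  qed blast
  show ?thesis
  proof (rule continuous_on_Times_Lipschitz)
    show "continuous_on {0..T} (\<lambda>t. momentum_potential t x)" if "x \<in> {0..1}" for x
      using momentum_potential_Dt[OF _ that] DERIV_continuous
      unfolding continuous_on_eq_continuous_within by blast
    show "\<bar>momentum_potential t x - momentum_potential t y\<bar> \<le> L * \<bar>x - y\<bar>"
      if "t \<in> {0..T}" "x \<in> {0..1}" "y \<in> {0..1}" for t x y
      using field_differentiable_bound[OF convex_real_interval(5) momentum_potential_Dx[OF that(1)], of L] L that
      by simp
  qed
qed

text \<open>Young's inequality bounds the momentum by half the sum of the density, whose integral is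
  1, and of \<open>\<rho> u^2\<close>, whose integral is at most \<open>E\<^sub>0\<close>.\<close>

lemma momentum_potential_le:
  assumes t: "t \<in> {0..T}" and x: "x \<in> {0..1}"
  shows "\<bar>momentum_potential t x\<bar> \<le> (1 + E\<^sub>0) / 2"
proof -
  have c: "continuous_on {0..1} (\<lambda>y. \<rho> t y * u t y)" "continuous_on {0..1} (\<rho> t)"
      "continuous_on {0..1} (\<lambda>y. \<rho> t y * (u t y)\<^sup>2)"
    by (intro continuous_intros continuous_on_slice[OF _ t] continuous_fields)+
  let ?h = "\<lambda>y. (\<rho> t y + \<rho> t y * (u t y)\<^sup>2) / 2"
  have ch: "continuous_on {0..1} ?h"
    by (intro continuous_intros c) simp
  have "norm (integral {0..x} (\<lambda>y. \<rho> t y * u t y)) \<le> integral {0..x} ?h"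
  proof (rule integral_norm_bound_integral)
    fix y assume "y \<in> {0..x}"
    then have r: "0 \<le> \<rho> t y" using density_nonneg[OF t] x by simp
    have "0 \<le> (\<bar>u t y\<bar> - 1)\<^sup>2" by simp
    then have "\<bar>u t y\<bar> \<le> (1 + (u t y)\<^sup>2) / 2" by (simp add: power2_diff)
    then have "\<rho> t y * \<bar>u t y\<bar> \<le> \<rho> t y * ((1 + (u t y)\<^sup>2) / 2)"
      using r by (rule mult_left_mono)
    then show "norm (\<rho> t y * u t y) \<le> ?h y"
      using r by (simp add: abs_mult algebra_simps)
  next
    show "(\<lambda>y. \<rho> t y * u t y) integrable_on {0..x}" "?h integrable_on {0..x}"
      by (rule integrable_continuous_interval, rule continuous_on_subset[OF c(1)] continuous_on_subset[OF ch],
          use x in force)+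
  qed
  also have "\<dots> \<le> integral {0..1} ?h"
    by (rule integral_subset_le)
      (use x density_nonneg[OF t] integrable_continuous_interval[OF ch]
        integrable_subinterval_real[OF integrable_continuous_interval[OF ch], of 0 x] in auto)
  also have "\<dots> = (integral {0..1} (\<rho> t) + integral {0..1} (\<lambda>y. \<rho> t y * (u t y)\<^sup>2)) / 2"
    using c by (simp add: integral_add integrable_continuous_interval)
  also have "\<dots> \<le> (1 + E\<^sub>0) / 2"
  proof -
    have "0 \<le> integral {0..t} gradient_sq"
      using t by (intro integral_nonneg integrable_continuous_interval
          continuous_on_subset[OF continuous_gradient_sq] gradient_sq_nonneg) auto
    then have "0 \<le> 2 * \<mu>_lo * integral {0..t} gradient_sq"
      using lo_pos by simp
    then show ?thesis
      using energy_estimate[OF t] mass[OF t] by simp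
  qed
  finally show ?thesis
    unfolding momentum_potential_def by simp
qed

lemma continuous_viscosity_ratio: "continuous_on {1..b} (\<lambda>s. \<mu> s / s)"
  using C1_nonneg_continuous[OF viscosity] by (auto intro!: continuous_intros elim: continuous_on_subset)

lemma log_viscosity_bounds:
  assumes "1 \<le> r"
  shows "\<mu>_lo * ln r \<le> log_viscosity r" "log_viscosity r \<le> \<mu>_hi * ln r"
proof -
  have I: "((\<lambda>s. c / s) has_integral c * ln r - c * ln 1) {1..r}" for c :: real
  proof (rule fundamental_theorem_of_calculus[OF assms])
    fix s assume "s \<in> {1..r}"
    then have "((\<lambda>s. c * ln s) has_real_derivative c * (1 / s)) (at s within {1..r})"
      by (intro DERIV_cmult has_field_derivative_at_within[OF DERIV_ln_divide]) simp
    then show "((\<lambda>s. c * ln s) has_vector_derivative c / s) (at s within {1..r})"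
      by (simp add: has_real_derivative_iff_has_vector_derivative)
  qed
  have i: "((\<lambda>s. \<mu> s / s) has_integral log_viscosity r) {1..r}"
    unfolding log_viscosity_def
    by (rule integrable_integral[OF integrable_continuous_interval[OF continuous_viscosity_ratio]])
  show "\<mu>_lo * ln r \<le> log_viscosity r"
    using has_integral_le[OF I[of \<mu>_lo] i] lo_le by (simp add: divide_right_mono)
  show "log_viscosity r \<le> \<mu>_hi * ln r"
    using has_integral_le[OF i I[of \<mu>_hi]] le_hi by (simp add: divide_right_mono)
qed

lemma DERIV_log_viscosity:
  assumes "1 < r"
  shows "(log_viscosity has_real_derivative \<mu> r / r) (at r)"
proof -
  have "(log_viscosity has_real_derivative \<mu> r / r) (at r within {1..r + 1})"
    unfolding log_viscosity_def[abs_def]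
    by (rule integral_has_real_derivative[OF continuous_viscosity_ratio]) (use assms in auto)
  moreover have "r \<in> interior {1..r + 1}"
    using assms by simp
  ultimately show ?thesis
    using at_within_interior by metis
qed

lemma continuous_log_viscosity: "continuous_on {1..b} log_viscosity"
  unfolding log_viscosity_def[abs_def]
  by (rule indefinite_integral_continuous_1[OF integrable_continuous_interval[OF continuous_viscosity_ratio]])

end

section \<open>Maximum principle for the density\<close>

context viscous_flow
begin

lemma total_energy_nonneg: "0 \<le> E\<^sub>0"
proof -
  have t: "0 \<in> {0..T}" using T_pos by simp
  have "0 \<le> integral {0..1} (\<lambda>x. \<rho> 0 x * (u 0 x)\<^sup>2)"
    by (intro integral_nonneg integrable_continuous_interval continuous_intros
        continuous_on_slice[OF _ t] continuous_fields) (use density_nonneg[OF t] in auto)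
  then show ?thesis
    using energy_estimate[OF t] by simp
qed

text \<open>This bounds \<open>log_viscosity \<rho> + \<psi>\<close> where \<open>\<rho> = 1\<close>
  or \<open>t = 0\<close>: there the density is at most \<open>max \<rho>_hi 1\<close>.\<close>

definition potential_bound :: real where
  "potential_bound = \<mu>_hi * ln (max \<rho>_hi 1) + (1 + E\<^sub>0) / 2"

lemma hi_pos: "0 < \<mu>_hi"
  using lo_pos lo_le[of 0] le_hi[of 0] by simp

text \<open>\<open>\<partial>\<^sub>t\<psi> + u \<partial>\<^sub>x\<psi> = G\<close> for the momentum potential \<open>\<psi>\<close>, and \<open>G = - D\<^sub>t (log_viscosity \<rho>) - p(\<rho>)\<close>, so
  \<open>log_viscosity \<rho> + \<psi>\<close> is nonincreasing along trajectories. Instead of following them, we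
  exclude maxima of \<open>log_viscosity \<rho> + \<psi> - \<eta> t\<close> at positive times on the set where \<open>\<rho> \<ge> 1\<close>.\<close>

lemma no_later_maximum:
  assumes \<eta>: "0 < \<eta>" and t: "t \<in> {0..T}" "0 < t" and x: "x \<in> {0..1}" and gt: "1 < \<rho> t x"
    and max: "\<And>s y. s \<in> {0..T} \<Longrightarrow> y \<in> {0..1} \<Longrightarrow> 1 \<le> \<rho> s y \<Longrightarrow>
      log_viscosity (\<rho> s y) + momentum_potential s y - \<eta> * s
      \<le> log_viscosity (\<rho> t x) + momentum_potential t x - \<eta> * t"
  shows False
proof -
  let ?m = "\<mu> (\<rho> t x) / \<rho> t x"
  let ?dt = "?m * \<rho>\<^sub>t t x + (G t x - \<rho> t x * (u t x)\<^sup>2) - \<eta> * 1"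
  let ?dx = "?m * \<rho>\<^sub>x t x + \<rho> t x * u t x"
  have log: "((\<lambda>z. log_viscosity (g z)) has_real_derivative ?m * D) (at y within S)"
    if "(g has_real_derivative D) (at y within S)" "g y = \<rho> t x" for g D y S
    using DERIV_chain2[of log_viscosity ?m g y D S] DERIV_log_viscosity[OF gt] that by simp
  have dt: "((\<lambda>s. log_viscosity (\<rho> s x) + momentum_potential s x - \<eta> * s) has_real_derivative ?dt)
      (at t within {0..T})"
    by (intro derivative_intros DERIV_cmult log has_Dt momentum_potential_Dt t x refl)
  \<comment> \<open>Only earlier times are compared, as \<open>t\<close> may be the final time. A
    negative derivative would give larger values just before \<open>t\<close>, where the density
    still exceeds 1.\<close>
  have "0 \<le> ?dt"
  proof (rule ccontr)
    assume "\<not> 0 \<le> ?dt"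
    then have "?dt < 0" by simp
    from has_real_derivative_neg_dec_left[OF dt this]
    obtain d where d: "0 < d" "\<And>h. 0 < h \<Longrightarrow> t - h \<in> {0..T} \<Longrightarrow> h < d \<Longrightarrow>
        log_viscosity (\<rho> t x) + momentum_potential t x - \<eta> * t
        < log_viscosity (\<rho> (t - h) x) + momentum_potential (t - h) x - \<eta> * (t - h)"
      by blast
    have "((\<lambda>s. \<rho> s x) \<longlongrightarrow> \<rho> t x) (at t within {0..T})"
      using continuous_on_slice_time[OF continuous_fields(1) x] t unfolding continuous_on_def by blast
    then have "\<forall>\<^sub>F s in at t within {0..T}. 1 < \<rho> s x"
      using gt by (rule order_tendstoD)
    then obtain e where e: "0 < e" "\<And>s. s \<in> {0..T} \<Longrightarrow> s \<noteq> t \<Longrightarrow> dist s t < e \<Longrightarrow> 1 < \<rho> s x"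
      unfolding eventually_at by blast
    define h where "h = min (min (d / 2) (e / 2)) t"
    have h: "0 < h" "h < d" "h < e" "t - h \<in> {0..T}"
      using d(1) e(1) t unfolding h_def by auto
    have "1 < \<rho> (t - h) x"
      using h by (intro e(2)) (auto simp: dist_real_def)
    then show False
      using d(2)[OF h(1,4,2)] max[OF h(4) x] by simp
  qed
  \<comment> \<open>At an end point the velocity vanishes; at an interior maximum the spatial
    derivative does. The maximum is local because the density exceeds 1 near
    \<open>x\<close>.\<close>
  moreover have "u t x * ?dx = 0"
  proof (cases "x \<in> \<Omega>")
    case False
    then have "x = 0 \<or> x = 1" using x by auto
    then show ?thesis using boundary_values[OF t(1)] by auto
  next
    case True
    have int: "x \<in> interior {0..1}" using True by simp
    have "((\<lambda>y. log_viscosity (\<rho> t y) + momentum_potential t y) has_real_derivative ?dx) (at x within {0..1})"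
      by (intro derivative_intros log has_Dx momentum_potential_Dx t x refl)
    then have dx: "((\<lambda>y. log_viscosity (\<rho> t y) + momentum_potential t y) has_real_derivative ?dx) (at x)"
      using at_within_interior[OF int] by simp
    have "(\<rho> t \<longlongrightarrow> \<rho> t x) (at x within {0..1})"
      using continuous_on_slice[OF continuous_fields(1) t(1)] x unfolding continuous_on_def by blast
    then have "\<forall>\<^sub>F y in at x within {0..1}. 1 < \<rho> t y"
      using gt by (rule order_tendstoD)
    then obtain e where e: "0 < e" "\<And>y. y \<in> {0..1} \<Longrightarrow> y \<noteq> x \<Longrightarrow> dist y x < e \<Longrightarrow> 1 < \<rho> t y"
      unfolding eventually_at by blast
    define d where "d = min e (min x (1 - x))"
    have "?dx = 0"
    proof (rule DERIV_local_max[OF dx])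
      show "0 < d" using e(1) True unfolding d_def by auto
      show "\<forall>y. \<bar>x - y\<bar> < d \<longrightarrow> log_viscosity (\<rho> t y) + momentum_potential t y
          \<le> log_viscosity (\<rho> t x) + momentum_potential t x"
      proof (intro allI impI)
        fix y assume y: "\<bar>x - y\<bar> < d"
        then have y1: "y \<in> {0..1}" unfolding d_def by auto
        have "1 \<le> \<rho> t y"
        proof (cases "y = x")
          case False
          then show ?thesis using e(2)[OF y1] y unfolding d_def by (simp add: dist_real_def abs_minus_commute)
        qed (use gt in simp)
        then show "log_viscosity (\<rho> t y) + momentum_potential t y
            \<le> log_viscosity (\<rho> t x) + momentum_potential t x"
          using max[OF t(1) y1] by simp
      qed
    qed
    then show ?thesis by simp
  qed
  \<comment> \<open>By the continuity equation the material derivative of the logarithmic term is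
    \<open>- \<mu> u\<^sub>x\<close>, which cancels the viscous part of \<open>G\<close>. The term
    with \<eta> makes the result strictly negative even where the pressure is 0.\<close>
  moreover have "?dt + u t x * ?dx = - p (\<rho> t x) - \<eta>"
    using gt unfolding continuity[OF t(1) x] flux_def
    by (simp add: field_simps power2_eq_square)
  moreover have "0 \<le> p (\<rho> t x)"
    using pressure density_nonneg[OF t(1) x] unfolding pressure_law_def by auto
  ultimately show False
    using \<eta> by linarith
qed

lemma initial_density_le_closed:
  assumes "x \<in> {0..1}"
  shows "\<rho> 0 x \<le> \<rho>_hi"
proof (rule le_on_unit_interval[OF _ _ assms])
  show "continuous_on {0..1} (\<rho> 0)"
    using T_pos by (intro continuous_on_slice[OF continuous_fields(1)]) simp
  show "\<rho> 0 y \<le> \<rho>_hi" if "y \<in> \<Omega>" for y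
    using initial_density_le[OF that] initial_values(1)[OF that] by simp
qed

lemma log_viscosity_potential_le:
  assumes \<eta>: "0 < \<eta>" and t: "t \<in> {0..T}" and x: "x \<in> {0..1}" and ge: "1 \<le> \<rho> t x"
  shows "log_viscosity (\<rho> t x) + momentum_potential t x - \<eta> * t \<le> potential_bound"
proof -
  define \<Phi> where "\<Phi> z = log_viscosity (\<rho> (fst z) (snd z)) + momentum_potential (fst z) (snd z) - \<eta> * fst z" for z
  define K where "K = Q \<inter> (\<lambda>z. \<rho> (fst z) (snd z)) -` {1..}"
  obtain L where L: "\<And>t x. t \<in> {0..T} \<Longrightarrow> x \<in> {0..1} \<Longrightarrow> \<bar>\<rho> t x\<bar> \<le> L"
    using bounded_on_rectangle[OF continuous_fields(1)] by metis
  have "closed K"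
    unfolding K_def by (intro continuous_closed_preimage continuous_fields closed_Times) auto
  moreover have "bounded K"
    unfolding K_def by (intro bounded_Int disjI1 bounded_Times) auto
  ultimately have "compact K"
    by (simp add: compact_eq_bounded_closed)
  moreover have KQ: "K \<subseteq> Q"
    unfolding K_def by auto
  have "continuous_on K \<Phi>"
    unfolding \<Phi>_def
  proof (intro continuous_intros)
    show "continuous_on K (\<lambda>z. log_viscosity (\<rho> (fst z) (snd z)))"
      by (rule continuous_on_compose2[OF continuous_log_viscosity[of L] continuous_on_subset[OF continuous_fields(1) KQ]])
        (use L in \<open>force simp: K_def\<close>)
    show "continuous_on K (\<lambda>z. momentum_potential (fst z) (snd z))"
      by (rule continuous_on_subset[OF continuous_momentum_potential KQ])
  qed
  moreover have mem: "(t, x) \<in> K"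
    using t x ge unfolding K_def by simp
  ultimately obtain z where z: "z \<in> K" "\<And>w. w \<in> K \<Longrightarrow> \<Phi> w \<le> \<Phi> z"
    using continuous_attains_sup[of K \<Phi>] by blast
  obtain t' x' where z': "z = (t', x')" by (cases z)
  have t': "t' \<in> {0..T}" and x': "x' \<in> {0..1}" and ge': "1 \<le> \<rho> t' x'"
    using z(1) unfolding z' K_def by auto
  have "\<Phi> z \<le> potential_bound"
  \<comment> \<open>A maximiser over the compact set \<open>K\<close> exists, and
    \<open>no_later_maximum\<close> excludes all positions except these two.\<close>
  proof (cases "\<rho> t' x' = 1 \<or> t' = 0")
    case True
    have ln0: "0 \<le> ln (max \<rho>_hi 1)" by simp
    have "log_viscosity (\<rho> t' x') \<le> \<mu>_hi * ln (max \<rho>_hi 1)"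
    proof -
      have "log_viscosity (\<rho> t' x') \<le> \<mu>_hi * ln (\<rho> t' x')"
        by (rule log_viscosity_bounds(2)[OF ge'])
      also have "\<rho> t' x' \<le> max \<rho>_hi 1"
        using True initial_density_le_closed[OF x'] by auto
      then have "\<mu>_hi * ln (\<rho> t' x') \<le> \<mu>_hi * ln (max \<rho>_hi 1)"
        using hi_pos ge' by (intro mult_left_mono) auto
      finally show ?thesis .
    qed
    moreover have "0 \<le> \<eta> * t'" using \<eta> t' by simp
    ultimately show ?thesis
      using abs_le_D1[OF momentum_potential_le[OF t' x']]
      unfolding \<Phi>_def z' potential_bound_def fst_conv snd_conv by linarith
  next
    case False
    then have "1 < \<rho> t' x'" "0 < t'" using ge' t' by auto
    then have False
    proof (intro no_later_maximum[OF \<eta> t' _ x'])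
      fix s y assume "s \<in> {0..T}" "y \<in> {0..1}" "1 \<le> \<rho> s y"
      then have "(s, y) \<in> K" unfolding K_def by simp
      from z(2)[OF this] show "log_viscosity (\<rho> s y) + momentum_potential s y - \<eta> * s
          \<le> log_viscosity (\<rho> t' x') + momentum_potential t' x' - \<eta> * t'"
        unfolding \<Phi>_def z' by simp
    qed
    then show ?thesis ..
  qed
  then show ?thesis
    using z(2)[OF mem] unfolding \<Phi>_def by simp
qed

text \<open>The potential enters twice, once in \<open>potential_bound\<close> and once when it is
  removed from the sum, so \<open>(1 + E\<^sub>0) / 2\<close> is doubled. The division by
  \<open>\<mu>_lo\<close> comes from \<open>\<mu>_lo * ln r \<le> log_viscosity r\<close>.\<close>

definition density_bound :: real where
  "density_bound = exp ((\<mu>_hi * ln (max \<rho>_hi 1) + (1 + E\<^sub>0)) / \<mu>_lo)"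

lemma density_le:
  assumes t: "t \<in> {0..T}" and x: "x \<in> {0..1}"
  shows "\<rho> t x \<le> density_bound"
proof (cases "1 \<le> \<rho> t x")
  case False
  have "1 \<le> density_bound"
    unfolding density_bound_def using lo_pos hi_pos total_energy_nonneg by simp
  then show ?thesis using False by simp
next
  case True
  \<comment> \<open>The choice \<open>e / T\<close> for \<eta> makes its contribution at most
    \<open>e\<close>, which is then arbitrary.\<close>
  have "log_viscosity (\<rho> t x) + momentum_potential t x \<le> potential_bound + e" if "0 < e" for e
  proof -
    have "e / T * t \<le> e" using that T_pos t by (simp add: field_simps)
    then show ?thesis
      using log_viscosity_potential_le[OF _ t x True, of "e / T"] that T_pos by simp
  qed
  then have "log_viscosity (\<rho> t x) + momentum_potential t x \<le> potential_bound"
    by (rule field_le_epsilon)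
  then have "\<mu>_lo * ln (\<rho> t x) \<le> \<mu>_hi * ln (max \<rho>_hi 1) + (1 + E\<^sub>0)"
    using log_viscosity_bounds(1)[OF True] momentum_potential_le[OF t x]
    unfolding potential_bound_def abs_le_iff by (simp add: add_divide_distrib)
  then have "ln (\<rho> t x) \<le> (\<mu>_hi * ln (max \<rho>_hi 1) + (1 + E\<^sub>0)) / \<mu>_lo"
    using lo_pos by (simp add: field_simps)
  then show ?thesis
    unfolding density_bound_def using True by (metis exp_le_cancel_iff exp_ln less_le_trans zero_less_one)
qed

end

section \<open>The viscous energy\<close>

text \<open>Cauchy-Schwarz on the unit interval, obtained from the nonnegative variance of
  \<open>\<bar>f\<bar>\<close> about its mean \<open>m\<close>.\<close>

lemma square_integral_abs_le:
  fixes f :: "real \<Rightarrow> real"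
  assumes f: "continuous_on {0..1} f"
  shows "(integral {0..1} (\<lambda>x. \<bar>f x\<bar>))\<^sup>2 \<le> integral {0..1} (\<lambda>x. (f x)\<^sup>2)"
proof -
  define m where "m = integral {0..1} (\<lambda>x. \<bar>f x\<bar>)"
  have i: "(\<lambda>x. \<bar>f x\<bar>) integrable_on {0..1}" "(\<lambda>x. (f x)\<^sup>2) integrable_on {0..1}"
    by (intro integrable_continuous_interval continuous_intros f)+
  have "0 \<le> integral {0..1} (\<lambda>x. (f x)\<^sup>2 - 2 * m * \<bar>f x\<bar> + m\<^sup>2)"
  proof (rule integral_nonneg)
    show "(\<lambda>x. (f x)\<^sup>2 - 2 * m * \<bar>f x\<bar> + m\<^sup>2) integrable_on {0..1}"
      by (intro integrable_continuous_interval continuous_intros f)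
    fix x :: real
    have "0 \<le> (\<bar>f x\<bar> - m)\<^sup>2" by simp
    then show "0 \<le> (f x)\<^sup>2 - 2 * m * \<bar>f x\<bar> + m\<^sup>2"
      by (simp add: power2_diff algebra_simps)
  qed
  also have "integral {0..1} (\<lambda>x. (f x)\<^sup>2 - 2 * m * \<bar>f x\<bar> + m\<^sup>2)
      = integral {0..1} (\<lambda>x. (f x)\<^sup>2) - 2 * m * m + m\<^sup>2"
    using has_integral_add[OF has_integral_diff[OF integrable_integral[OF i(2)]
        has_integral_mult_right[OF integrable_integral[OF i(1)], of "2 * m"]]
        has_integral_const_real[of "m\<^sup>2" 0 1]]
    by (simp add: integral_unique flip: m_def)
  finally show ?thesis
    unfolding m_def[symmetric] by (simp add: power2_eq_square)
qed

context viscous_flow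
begin

definition acceleration_sq :: "real \<Rightarrow> real" where
  "acceleration_sq t = integral {0..1} (\<lambda>x. \<rho> t x * (material_deriv T u t x)\<^sup>2)"

definition viscous_energy :: "real \<Rightarrow> real" where
  "viscous_energy t = integral {0..1} (\<lambda>x. \<mu> (\<rho> t x) * (u\<^sub>x t x)\<^sup>2 / 2 - p (\<rho> t x) * u\<^sub>x t x)"

lemma continuous_acceleration_sq: "continuous_on {0..T} acceleration_sq"
  unfolding acceleration_sq_def[abs_def]
  by (rule continuous_on_integral_slice)
    (intro continuous_intros continuous_fields continuous_material_deriv)

lemma acceleration_sq_nonneg: "t \<in> {0..T} \<Longrightarrow> 0 \<le> acceleration_sq t"
  unfolding acceleration_sq_def
  by (rule integral_nonneg)
    (auto intro!: integrable_slice continuous_intros continuous_fields continuous_material_deriv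
      density_nonneg mult_nonneg_nonneg)

text \<open>Testing the momentum equation with \<open>\<partial>\<^sub>t u + u \<partial>\<^sub>x u\<close>: the second derivatives of \<open>u\<close> combine
  into the \<open>x\<close>-derivative of \<open>G (\<partial>\<^sub>t u + u \<partial>\<^sub>x u) - u h\<close>, where \<open>h\<close> is the integrand of the
  viscous energy, and this function vanishes on the boundary.\<close>

lemma has_derivative_viscous_energy:
  assumes t: "t \<in> {0..T}"
  shows "(viscous_energy has_real_derivative
    integral {0..1} (\<lambda>x. \<rho> t x * deriv_nonneg p (\<rho> t x) * (u\<^sub>x t x)\<^sup>2
      - (\<mu> (\<rho> t x) + \<rho> t x * deriv_nonneg \<mu> (\<rho> t x)) / 2 * u\<^sub>x t x ^ 3)
    - acceleration_sq t) (at t within {0..T})"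
proof -
  let ?a = "material_deriv T u"
  define h' where "h' s x = (deriv_nonneg \<mu> (\<rho> s x) * \<rho>\<^sub>t s x * (u\<^sub>x s x)\<^sup>2
      + of_nat 2 * (u\<^sub>x\<^sub>t s x * u\<^sub>x s x ^ (2 - Suc 0)) * \<mu> (\<rho> s x)) / 2
    - (deriv_nonneg p (\<rho> s x) * \<rho>\<^sub>t s x * u\<^sub>x s x + u\<^sub>x\<^sub>t s x * p (\<rho> s x))" for s x
  define N where "N x = \<rho> t x * deriv_nonneg p (\<rho> t x) * (u\<^sub>x t x)\<^sup>2
      - (\<mu> (\<rho> t x) + \<rho> t x * deriv_nonneg \<mu> (\<rho> t x)) / 2 * u\<^sub>x t x ^ 3" for x
  define hx where "hx x = (deriv_nonneg \<mu> (\<rho> t x) * \<rho>\<^sub>x t x * (u\<^sub>x t x)\<^sup>2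
      + of_nat 2 * (u\<^sub>x\<^sub>x t x * u\<^sub>x t x ^ (2 - Suc 0)) * \<mu> (\<rho> t x)) / 2
    - (deriv_nonneg p (\<rho> t x) * \<rho>\<^sub>x t x * u\<^sub>x t x + u\<^sub>x\<^sub>x t x * p (\<rho> t x))" for x
  define K' where "K' x = (G\<^sub>x t x * ?a t x + (u\<^sub>x\<^sub>t t x + (u\<^sub>x t x * u\<^sub>x t x + u\<^sub>x\<^sub>x t x * u t x)) * G t x)
    - (hx x * u t x + u\<^sub>x t x * (\<mu> (\<rho> t x) * (u\<^sub>x t x)\<^sup>2 / 2 - p (\<rho> t x) * u\<^sub>x t x))" for x
  note cont = continuous_fields continuous_coefficients continuous_flux continuous_material_deriv
  have "(viscous_energy has_real_derivative integral {0..1} (h' t)) (at t within {0..T})"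
    unfolding viscous_energy_def[abs_def]
  proof (rule has_derivative_integral_slice)
    show "((\<lambda>s. \<mu> (\<rho> s x) * (u\<^sub>x s x)\<^sup>2 / 2 - p (\<rho> s x) * u\<^sub>x s x) has_real_derivative h' s x)
        (at s within {0..T})" if "s \<in> {0..T}" "x \<in> {0..1}" for s x
      unfolding h'_def
      by (intro derivative_intros DERIV_cdivide has_derivative_coefficients has_Dt that)
  qed (use t in \<open>auto simp: h'_def intro!: continuous_intros cont\<close>)
  moreover have "h' t x = K' x + (N x - \<rho> t x * (?a t x)\<^sup>2)" if x: "x \<in> {0..1}" for x
    unfolding h'_def K'_def hx_def N_def continuity[OF t x] momentum[OF t x] flux_def
    by (simp add: field_simps power2_eq_square power3_eq_cube)
  then have "integral {0..1} (h' t) = integral {0..1} (\<lambda>x. K' x + (N x - \<rho> t x * (?a t x)\<^sup>2))"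
    by (intro integral_cong)
  moreover have "\<dots> = integral {0..1} K' + (integral {0..1} N - acceleration_sq t)"
  proof -
    have "K' integrable_on {0..1}" "N integrable_on {0..1}"
      "(\<lambda>x. \<rho> t x * (?a t x)\<^sup>2) integrable_on {0..1}"
      unfolding K'_def hx_def N_def
      by (intro integrable_continuous_interval continuous_intros continuous_on_slice[OF _ t] cont; simp)+
    then show ?thesis
      unfolding acceleration_sq_def by (simp add: integral_add integral_diff integrable_diff)
  qed
  moreover have "integral {0..1} K' = 0"
  proof -
    let ?K = "\<lambda>x. G t x * ?a t x - (\<mu> (\<rho> t x) * (u\<^sub>x t x)\<^sup>2 / 2 - p (\<rho> t x) * u\<^sub>x t x) * u t x"
    \<comment> \<open>The time derivative of the viscous energy produces
      \<open>u\<^sub>x\<^sub>t\<close>, the \<open>x\<close>-derivative of the acceleration the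
      opposite order; symmetry of mixed derivatives makes the two cancel.\<close>
    have a: "(?a t has_real_derivative u\<^sub>x\<^sub>t t x + (u\<^sub>x t x * u\<^sub>x t x + u\<^sub>x\<^sub>x t x * u t x)) (at x within {0..1})"
      if x: "x \<in> {0..1}" for x
    proof -
      have "((\<lambda>x. u\<^sub>t t x + u t x * u\<^sub>x t x) has_real_derivative
          Dx (Dt T u) t x + (u\<^sub>x t x * u\<^sub>x t x + u\<^sub>x\<^sub>x t x * u t x)) (at x within {0..1})"
        by (intro derivative_intros has_Dx t x smooth_on_has_Dx[OF smooth_on_Dt[OF smooth_velocity]])
      then show ?thesis
        unfolding material_deriv_def[abs_def] Dt_Dx_commute[OF smooth_velocity T_pos t x] .
    qed
    have "integral {0..1} K' = ?K 1 - ?K 0"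
      unfolding K'_def hx_def
      by (rule integral_Dx, simp, simp,
          intro derivative_intros DERIV_cdivide a has_derivative_coefficients has_Dx flux_has_Dx t)
    then show ?thesis
      using boundary_values[OF t] by simp
  qed
  ultimately show ?thesis
    by (simp add: N_def[abs_def])
qed

end

text \<open>The constants are parameters so that the dependence of the final bound stays explicit.
  \<open>M\<close> will be the density bound; \<open>P\<close>, \<open>A\<close> and
  \<open>B\<close> bound, on \<open>[0,M]\<close>, the pressure and the coefficients of the cubic
  and quadratic terms in the derivative of the viscous energy.\<close>

locale bounded_viscous_flow = viscous_flow +
  fixes M P A B :: real
  assumes density_le_M: "\<And>t x. t \<in> {0..T} \<Longrightarrow> x \<in> {0..1} \<Longrightarrow> \<rho> t x \<le> M"
    and M_pos: "0 < M"
    and pressure_le: "\<And>r. 0 \<le> r \<Longrightarrow> r \<le> M \<Longrightarrow> p r \<le> P"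
    and cubic_coefficient_le: "\<And>r. 0 \<le> r \<Longrightarrow> r \<le> M \<Longrightarrow> \<bar>(\<mu> r + r * deriv_nonneg \<mu> r) / 2\<bar> \<le> A"
    and quadratic_coefficient_le: "\<And>r. 0 \<le> r \<Longrightarrow> r \<le> M \<Longrightarrow> r * deriv_nonneg p r \<le> B"
begin

lemma constants_nonneg: "0 \<le> P" "0 \<le> A" "0 \<le> B"
proof -
  have "0 \<le> p 0" using pressure unfolding pressure_law_def by simp
  then show "0 \<le> P" using pressure_le[of 0] M_pos by simp
  show "0 \<le> A" using cubic_coefficient_le[of 0] M_pos by simp
  show "0 \<le> B" using quadratic_coefficient_le[of 0] M_pos by simp
qed

definition gradient_bound :: "real \<Rightarrow> real" where
  "gradient_bound t = (sqrt (M * acceleration_sq t) + P) / \<mu>_lo"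

text \<open>The momentum equation gives \<open>G\<^sub>x\<close> a full factor of the density.
  Squared, one factor is spent on the upper bound \<open>M\<close> and the other stays as weight, so
  vacuum causes no loss.\<close>

lemma flux_deriv_sq_le:
  assumes t: "t \<in> {0..T}" and x: "x \<in> {0..1}"
  shows "(G\<^sub>x t x)\<^sup>2 \<le> M * (\<rho> t x * (material_deriv T u t x)\<^sup>2)"
proof -
  have "\<rho> t x * (\<rho> t x * (material_deriv T u t x)\<^sup>2) \<le> M * (\<rho> t x * (material_deriv T u t x)\<^sup>2)"
    using density_nonneg[OF t x] density_le_M[OF t x] by (intro mult_right_mono) auto
  then show ?thesis
    unfolding momentum[OF t x] by (simp add: power_mult_distrib power2_eq_square ac_simps)
qed

lemma flux_le:
  assumes t: "t \<in> {0..T}" and x: "x \<in> {0..1}"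
  shows "\<bar>G t x\<bar> \<le> sqrt (M * acceleration_sq t)"
proof -
  have c: "continuous_on {0..1} (G\<^sub>x t)"
    by (rule continuous_on_slice[OF continuous_flux(2) t])
  note i = integrable_continuous_interval[OF c]
  have ia: "(\<lambda>y. \<bar>G\<^sub>x t y\<bar>) integrable_on {0..1}"
    by (intro integrable_continuous_interval continuous_intros c)
  have sub: "{0..x} \<subseteq> {0..1}" using x by auto
  have "G t x = integral {0..x} (G\<^sub>x t)"
    using integral_Dx[of x "G t" "G\<^sub>x t"] flux_has_Dx[OF t] boundary_values[OF t] x by simp
  also have "\<bar>\<dots>\<bar> \<le> integral {0..x} (\<lambda>y. \<bar>G\<^sub>x t y\<bar>)"
    using integral_norm_bound_integral[of "G\<^sub>x t" "{0..x}" "\<lambda>y. \<bar>G\<^sub>x t y\<bar>"]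
      integrable_on_subinterval[OF i sub] integrable_on_subinterval[OF ia sub] by simp
  also have "\<dots> \<le> integral {0..1} (\<lambda>y. \<bar>G\<^sub>x t y\<bar>)"
    using integrable_on_subinterval[OF ia sub] ia by (intro integral_subset_le sub) auto
  also have "\<dots> \<le> sqrt (integral {0..1} (\<lambda>y. (G\<^sub>x t y)\<^sup>2))"
    by (rule real_le_rsqrt[OF square_integral_abs_le[OF c]])
  also have "\<dots> \<le> sqrt (M * acceleration_sq t)"
  proof -
    have "integral {0..1} (\<lambda>y. (G\<^sub>x t y)\<^sup>2) \<le> integral {0..1} (\<lambda>y. M * (\<rho> t y * (material_deriv T u t y)\<^sup>2))"
      by (intro integral_le integrable_continuous_interval continuous_intros c
          continuous_on_slice[OF _ t] continuous_fields continuous_material_deriv flux_deriv_sq_le[OF t])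
    then show ?thesis
      unfolding acceleration_sq_def by simp
  qed
  finally show ?thesis .
qed

lemma gradient_le:
  assumes t: "t \<in> {0..T}" and x: "x \<in> {0..1}"
  shows "\<bar>u\<^sub>x t x\<bar> \<le> gradient_bound t"
proof -
  note r = density_nonneg[OF t x] density_le_M[OF t x]
  have "\<mu>_lo * \<bar>u\<^sub>x t x\<bar> \<le> \<mu> (\<rho> t x) * \<bar>u\<^sub>x t x\<bar>"
    using lo_le[OF r(1)] by (intro mult_right_mono) auto
  also have "\<dots> = \<bar>G t x + p (\<rho> t x)\<bar>"
    using lo_le[OF r(1)] lo_pos by (simp add: flux_def abs_mult)
  also have "\<dots> \<le> sqrt (M * acceleration_sq t) + P"
  proof -
    have "0 \<le> p (\<rho> t x)" using pressure r unfolding pressure_law_def by simp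
    then show ?thesis using flux_le[OF t x] pressure_le[OF r] by simp
  qed
  finally show ?thesis
    unfolding gradient_bound_def using lo_pos by (simp add: field_simps)
qed

lemma gradient_bound_nonneg: "t \<in> {0..T} \<Longrightarrow> 0 \<le> gradient_bound t"
  unfolding gradient_bound_def using lo_pos M_pos constants_nonneg acceleration_sq_nonneg by simp

lemma integrable_gradient_sq: "t \<in> {0..T} \<Longrightarrow> (\<lambda>x. (u\<^sub>x t x)\<^sup>2) integrable_on {0..1}"
  by (rule integrable_slice) (intro continuous_intros continuous_fields)

lemma integrable_viscous_energy:
  "t \<in> {0..T} \<Longrightarrow> (\<lambda>x. \<mu> (\<rho> t x) * (u\<^sub>x t x)\<^sup>2 / 2 - p (\<rho> t x) * u\<^sub>x t x) integrable_on {0..1}"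
  by (rule integrable_slice) (intro continuous_intros continuous_fields continuous_coefficients; simp)

lemma viscous_energy_deriv_le:
  assumes t: "t \<in> {0..T}"
  shows "integral {0..1} (\<lambda>x. \<rho> t x * deriv_nonneg p (\<rho> t x) * (u\<^sub>x t x)\<^sup>2
      - (\<mu> (\<rho> t x) + \<rho> t x * deriv_nonneg \<mu> (\<rho> t x)) / 2 * u\<^sub>x t x ^ 3) - acceleration_sq t
    \<le> - acceleration_sq t / 2 + A\<^sup>2 * M / (2 * \<mu>_lo\<^sup>2) * (gradient_sq t)\<^sup>2
      + (A * P / \<mu>_lo + B) * gradient_sq t"
proof -
  let ?S = "gradient_bound t"
  have "integral {0..1} (\<lambda>x. \<rho> t x * deriv_nonneg p (\<rho> t x) * (u\<^sub>x t x)\<^sup>2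
      - (\<mu> (\<rho> t x) + \<rho> t x * deriv_nonneg \<mu> (\<rho> t x)) / 2 * u\<^sub>x t x ^ 3)
    \<le> integral {0..1} (\<lambda>x. (B + A * ?S) * (u\<^sub>x t x)\<^sup>2)"
  proof (rule integral_le)
    show "(\<lambda>x. \<rho> t x * deriv_nonneg p (\<rho> t x) * (u\<^sub>x t x)\<^sup>2
      - (\<mu> (\<rho> t x) + \<rho> t x * deriv_nonneg \<mu> (\<rho> t x)) / 2 * u\<^sub>x t x ^ 3) integrable_on {0..1}"
      "(\<lambda>x. (B + A * ?S) * (u\<^sub>x t x)\<^sup>2) integrable_on {0..1}"
      by (intro integrable_continuous_interval continuous_intros continuous_on_slice[OF _ t]
          continuous_fields continuous_coefficients; simp)+
    fix x :: real assume x: "x \<in> {0..1}"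
    note r = density_nonneg[OF t x] density_le_M[OF t x]
    let ?c = "(\<mu> (\<rho> t x) + \<rho> t x * deriv_nonneg \<mu> (\<rho> t x)) / 2"
    have "- (?c * u\<^sub>x t x ^ 3) \<le> \<bar>?c\<bar> * \<bar>u\<^sub>x t x\<bar> * (u\<^sub>x t x)\<^sup>2"
      using abs_ge_minus_self[of "?c * u\<^sub>x t x ^ 3"] by (simp add: abs_mult power3_eq_cube power2_eq_square)
    also have "\<dots> \<le> A * ?S * (u\<^sub>x t x)\<^sup>2"
      by (intro mult_right_mono mult_mono cubic_coefficient_le r gradient_le t x constants_nonneg) auto
    finally have "- (?c * u\<^sub>x t x ^ 3) \<le> A * ?S * (u\<^sub>x t x)\<^sup>2" .
    moreover have "\<rho> t x * deriv_nonneg p (\<rho> t x) * (u\<^sub>x t x)\<^sup>2 \<le> B * (u\<^sub>x t x)\<^sup>2"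
      by (intro mult_right_mono quadratic_coefficient_le r) auto
    ultimately show "\<rho> t x * deriv_nonneg p (\<rho> t x) * (u\<^sub>x t x)\<^sup>2 - ?c * u\<^sub>x t x ^ 3
        \<le> (B + A * ?S) * (u\<^sub>x t x)\<^sup>2"
      by (simp add: algebra_simps)
  qed
  also have "\<dots> = (B + A * ?S) * gradient_sq t"
    unfolding gradient_sq_def by simp
  also have "\<dots> \<le> acceleration_sq t / 2 + A\<^sup>2 * M / (2 * \<mu>_lo\<^sup>2) * (gradient_sq t)\<^sup>2
      + (A * P / \<mu>_lo + B) * gradient_sq t"
  proof -
    define s where "s = sqrt (acceleration_sq t)"
    \<comment> \<open>Chosen so that \<open>w * s\<close> is the part of
      \<open>A * gradient_bound t * gradient_sq t\<close> containing the acceleration. Young's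
      inequality then spends half of \<open>acceleration_sq\<close> and leaves the square of
      \<open>gradient_sq\<close>.\<close>
    define w where "w = A * sqrt M / \<mu>_lo * gradient_sq t"
    have s2: "s\<^sup>2 = acceleration_sq t"
      unfolding s_def using acceleration_sq_nonneg[OF t] by simp
    have w2: "w\<^sup>2 = A\<^sup>2 * M / \<mu>_lo\<^sup>2 * (gradient_sq t)\<^sup>2"
      unfolding w_def using M_pos by (simp add: power_mult_distrib power_divide)
    have "0 \<le> (s - w)\<^sup>2" by simp
    then have "w * s \<le> s\<^sup>2 / 2 + w\<^sup>2 / 2" by (simp add: power2_diff algebra_simps)
    moreover have "(B + A * ?S) * gradient_sq t = w * s + (A * P / \<mu>_lo + B) * gradient_sq t"
      unfolding gradient_bound_def w_def s_def by (simp add: real_sqrt_mult add_divide_distrib algebra_simps)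
    ultimately show ?thesis unfolding s2 w2 by simp
  qed
  finally show ?thesis by simp
qed

text \<open>The constant comes from \<open>P y \<le> \<mu>_lo / 4 y^2 + P^2 / \<mu>_lo\<close>: it
  compensates the pressure term of the viscous energy, which has no sign, while retaining half of
  the viscous lower bound.\<close>

definition shifted_energy :: "real \<Rightarrow> real" where
  "shifted_energy t = viscous_energy t + P\<^sup>2 / \<mu>_lo"

lemma gradient_sq_le_shifted_energy:
  assumes t: "t \<in> {0..T}"
  shows "\<mu>_lo / 4 * gradient_sq t \<le> shifted_energy t"
proof -
  have "integral {0..1} (\<lambda>x. \<mu>_lo / 4 * (u\<^sub>x t x)\<^sup>2 - P\<^sup>2 / \<mu>_lo) \<le> viscous_energy t"
    unfolding viscous_energy_def
  proof (rule integral_le[OF _ integrable_viscous_energy[OF t]])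
    show "(\<lambda>x. \<mu>_lo / 4 * (u\<^sub>x t x)\<^sup>2 - P\<^sup>2 / \<mu>_lo) integrable_on {0..1}"
      by (intro integrable_continuous_interval continuous_intros continuous_on_slice[OF _ t] continuous_fields)
    fix x :: real assume x: "x \<in> {0..1}"
    note r = density_nonneg[OF t x] density_le_M[OF t x]
    have "p (\<rho> t x) * u\<^sub>x t x \<le> P * \<bar>u\<^sub>x t x\<bar>"
    proof -
      have "0 \<le> p (\<rho> t x)" using pressure r unfolding pressure_law_def by simp
      then have "p (\<rho> t x) * u\<^sub>x t x \<le> p (\<rho> t x) * \<bar>u\<^sub>x t x\<bar>" by (intro mult_left_mono) auto
      also have "\<dots> \<le> P * \<bar>u\<^sub>x t x\<bar>" using pressure_le[OF r] by (intro mult_right_mono) auto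
      finally show ?thesis .
    qed
    moreover have "P * \<bar>u\<^sub>x t x\<bar> \<le> \<mu>_lo / 4 * (u\<^sub>x t x)\<^sup>2 + P\<^sup>2 / \<mu>_lo"
    proof -
      have "0 \<le> (\<mu>_lo / 2 * \<bar>u\<^sub>x t x\<bar> - P)\<^sup>2 / \<mu>_lo" using lo_pos by simp
      also have "\<dots> = \<mu>_lo / 4 * (u\<^sub>x t x)\<^sup>2 + P\<^sup>2 / \<mu>_lo - P * \<bar>u\<^sub>x t x\<bar>"
        using lo_pos by (simp add: power2_diff power_mult_distrib field_simps power2_eq_square)
      finally show ?thesis by simp
    qed
    moreover have "\<mu>_lo * (u\<^sub>x t x)\<^sup>2 \<le> \<mu> (\<rho> t x) * (u\<^sub>x t x)\<^sup>2"
      using lo_le[OF r(1)] by (intro mult_right_mono) auto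
    ultimately show "\<mu>_lo / 4 * (u\<^sub>x t x)\<^sup>2 - P\<^sup>2 / \<mu>_lo
        \<le> \<mu> (\<rho> t x) * (u\<^sub>x t x)\<^sup>2 / 2 - p (\<rho> t x) * u\<^sub>x t x"
      by simp
  qed
  moreover have "integral {0..1} (\<lambda>x. \<mu>_lo / 4 * (u\<^sub>x t x)\<^sup>2 - P\<^sup>2 / \<mu>_lo) = \<mu>_lo / 4 * gradient_sq t - P\<^sup>2 / \<mu>_lo"
    unfolding gradient_sq_def using integrable_cmul[OF integrable_gradient_sq[OF t], of "\<mu>_lo / 4"]
    by (subst integral_diff) auto
  ultimately show ?thesis
    unfolding shifted_energy_def by simp
qed

text \<open>Differentiating the weight \<open>t\<close> leaves the unweighted
  \<open>shifted_energy\<close>; this bound lets its time integral be controlled by the energy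
  estimate.\<close>

lemma shifted_energy_le:
  assumes t: "t \<in> {0..T}"
  shows "shifted_energy t \<le> (\<mu>_hi + 1) / 2 * gradient_sq t + (P\<^sup>2 / 2 + P\<^sup>2 / \<mu>_lo)"
proof -
  have "viscous_energy t \<le> integral {0..1} (\<lambda>x. (\<mu>_hi + 1) / 2 * (u\<^sub>x t x)\<^sup>2 + P\<^sup>2 / 2)"
    unfolding viscous_energy_def
  proof (rule integral_le[OF integrable_viscous_energy[OF t]])
    show "(\<lambda>x. (\<mu>_hi + 1) / 2 * (u\<^sub>x t x)\<^sup>2 + P\<^sup>2 / 2) integrable_on {0..1}"
      by (intro integrable_continuous_interval continuous_intros continuous_on_slice[OF _ t] continuous_fields)
    fix x :: real assume x: "x \<in> {0..1}"
    note r = density_nonneg[OF t x] density_le_M[OF t x]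
    have p0: "0 \<le> p (\<rho> t x)" using pressure r unfolding pressure_law_def by simp
    have "0 \<le> (p (\<rho> t x) + u\<^sub>x t x)\<^sup>2" by simp
    then have "- (p (\<rho> t x) * u\<^sub>x t x) \<le> (p (\<rho> t x))\<^sup>2 / 2 + (u\<^sub>x t x)\<^sup>2 / 2"
      by (simp add: power2_sum)
    moreover have "(p (\<rho> t x))\<^sup>2 \<le> P\<^sup>2"
      using p0 pressure_le[OF r] by (intro power_mono)
    moreover have "\<mu> (\<rho> t x) * (u\<^sub>x t x)\<^sup>2 \<le> \<mu>_hi * (u\<^sub>x t x)\<^sup>2"
      using le_hi[OF r(1)] by (intro mult_right_mono) auto
    ultimately show "\<mu> (\<rho> t x) * (u\<^sub>x t x)\<^sup>2 / 2 - p (\<rho> t x) * u\<^sub>x t x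
        \<le> (\<mu>_hi + 1) / 2 * (u\<^sub>x t x)\<^sup>2 + P\<^sup>2 / 2"
      by (simp add: algebra_simps add_divide_distrib)
  qed
  moreover have "integral {0..1} (\<lambda>x. (\<mu>_hi + 1) / 2 * (u\<^sub>x t x)\<^sup>2 + P\<^sup>2 / 2)
      = (\<mu>_hi + 1) / 2 * gradient_sq t + P\<^sup>2 / 2"
    unfolding gradient_sq_def using integrable_cmul[OF integrable_gradient_sq[OF t], of "(\<mu>_hi + 1) / 2"]
    by (subst integral_add) auto
  ultimately show ?thesis
    unfolding shifted_energy_def by simp
qed

end

section \<open>The weighted estimate\<close>

lemma has_integral_const_0:
  fixes c t :: real
  shows "0 \<le> t \<Longrightarrow> ((\<lambda>_. c) has_integral t * c) {0..t}"
  using has_integral_const_real[of c 0 t] by simp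

text \<open>The first factor is the Gronwall rate per unit of \<open>gradient_sq\<close>, and
  \<open>E / (2 * \<mu>\<^sub>l)\<close> is the energy bound for the time integral of
  \<open>gradient_sq\<close>.\<close>

definition gronwall_exponent :: "real \<Rightarrow> real \<Rightarrow> real \<Rightarrow> real \<Rightarrow> real" where
  "gronwall_exponent M A \<mu>\<^sub>l E = 2 * A\<^sup>2 * M / \<mu>\<^sub>l ^ 3 * (E / (2 * \<mu>\<^sub>l))"

text \<open>The time integral of \<open>shifted_energy s + T * (A * P / \<mu>\<^sub>l + B) *
  gradient_sq s\<close>, after \<open>shifted_energy_le\<close> and the energy bound have been
  inserted.\<close>

definition source_bound :: "real \<Rightarrow> real \<Rightarrow> real \<Rightarrow> real \<Rightarrow> real \<Rightarrow> real \<Rightarrow> real \<Rightarrow> real" where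
  "source_bound P A B \<mu>\<^sub>l \<mu>\<^sub>h E T =
    ((\<mu>\<^sub>h + 1) / 2 + T * (A * P / \<mu>\<^sub>l + B)) * (E / (2 * \<mu>\<^sub>l)) + T * (P\<^sup>2 / 2 + P\<^sup>2 / \<mu>\<^sub>l)"

definition weighted_bound :: "real \<Rightarrow> real \<Rightarrow> real \<Rightarrow> real \<Rightarrow> real \<Rightarrow> real \<Rightarrow> real \<Rightarrow> real \<Rightarrow> real" where
  "weighted_bound M P A B \<mu>\<^sub>l \<mu>\<^sub>h E T =
    exp (gronwall_exponent M A \<mu>\<^sub>l E) * source_bound P A B \<mu>\<^sub>l \<mu>\<^sub>h E T"

context bounded_viscous_flow
begin

abbreviation "C\<^sub>w \<equiv> weighted_bound M P A B \<mu>_lo \<mu>_hi E\<^sub>0 T"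

lemma integral_gradient_sq_le:
  assumes t: "t \<in> {0..T}"
  shows "0 \<le> integral {0..t} gradient_sq" "integral {0..t} gradient_sq \<le> E\<^sub>0 / (2 * \<mu>_lo)"
proof -
  show "0 \<le> integral {0..t} gradient_sq"
    using t by (intro integral_nonneg integrable_continuous_interval
        continuous_on_subset[OF continuous_gradient_sq] gradient_sq_nonneg) auto
  have "0 \<le> integral {0..1} (\<lambda>x. \<rho> t x * (u t x)\<^sup>2)"
    by (intro integral_nonneg integrable_continuous_interval continuous_intros
        continuous_on_slice[OF _ t] continuous_fields) (use density_nonneg[OF t] in auto)
  then have "2 * \<mu>_lo * integral {0..t} gradient_sq \<le> E\<^sub>0"
    using energy_estimate[OF t] by simp
  then show "integral {0..t} gradient_sq \<le> E\<^sub>0 / (2 * \<mu>_lo)"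
    using lo_pos by (simp add: field_simps)
qed

lemma continuous_shifted_energy: "continuous_on {0..T} shifted_energy"
  unfolding shifted_energy_def[abs_def] viscous_energy_def
  by (intro continuous_intros continuous_on_integral_slice continuous_fields continuous_coefficients) simp

lemma shifted_energy_nonneg: "t \<in> {0..T} \<Longrightarrow> 0 \<le> shifted_energy t"
  using gradient_sq_le_shifted_energy[of t] gradient_sq_nonneg[of t] lo_pos
  by (meson divide_nonneg_pos less_eq_real_def mult_nonneg_nonneg order_trans zero_less_numeral)

text \<open>Gronwall's inequality by an integrating factor: multiplication by
  \<open>exp (- (k * W t))\<close> removes the term proportional to \<open>gradient_sq\<close> times
  the functional. Initially everything vanishes thanks to the weight \<open>t\<close>.\<close>

lemma weighted_estimate:
  assumes t: "t \<in> {0..T}"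
  shows "t * shifted_energy t + integral {0..t} (\<lambda>s. s * acceleration_sq s / 2) \<le> C\<^sub>w"
proof -
  define k where "k = 2 * A\<^sup>2 * M / \<mu>_lo ^ 3"
  define l where "l = A * P / \<mu>_lo + B"
  define W where "W t = integral {0..t} gradient_sq" for t
  define \<phi> where "\<phi> t = exp (- (k * W t))" for t
  define src where "src s = shifted_energy s + T * l * gradient_sq s" for s
  \<comment> \<open>The factor \<phi> stays inside the acceleration integral but is dropped from the
    source, which is legitimate because \<open>\<phi> \<le> 1\<close> and the source is nonnegative;
    thus \<open>Z\<close> is nonincreasing.\<close>
  define Z where "Z s = \<phi> s * (s * shifted_energy s) + integral {0..s} (\<lambda>s. \<phi> s * (s * acceleration_sq s / 2))
    - integral {0..s} src" for s
  define D where "D s = integral {0..1} (\<lambda>x. \<rho> s x * deriv_nonneg p (\<rho> s x) * (u\<^sub>x s x)\<^sup>2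
      - (\<mu> (\<rho> s x) + \<rho> s x * deriv_nonneg \<mu> (\<rho> s x)) / 2 * u\<^sub>x s x ^ 3) - acceleration_sq s" for s
  have l0: "0 \<le> l" and k0: "0 \<le> k"
    unfolding l_def k_def using constants_nonneg lo_pos M_pos by simp_all
  have W: "(W has_real_derivative gradient_sq s) (at s within {0..T})" if "s \<in> {0..T}" for s
    unfolding W_def[abs_def] using integral_has_real_derivative[OF continuous_gradient_sq that] .
  have \<phi>: "(\<phi> has_real_derivative \<phi> s * - (k * gradient_sq s)) (at s within {0..T})" if "s \<in> {0..T}" for s
    unfolding \<phi>_def[abs_def]
    by (intro DERIV_chain2[OF DERIV_exp] DERIV_minus DERIV_cmult W that)
  have c\<phi>: "continuous_on {0..T} \<phi>"
    using \<phi> DERIV_continuous unfolding continuous_on_eq_continuous_within by blast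
  have csrc: "continuous_on {0..T} src"
    unfolding src_def[abs_def] by (intro continuous_intros continuous_shifted_energy continuous_gradient_sq)
  have cacc: "continuous_on {0..T} (\<lambda>s. s * acceleration_sq s / 2)"
    by (intro continuous_intros continuous_acceleration_sq) simp
  have \<phi>1: "\<phi> s \<le> 1" "0 < \<phi> s" "exp (- gronwall_exponent M A \<mu>_lo E\<^sub>0) \<le> \<phi> s" if s: "s \<in> {0..T}" for s
  proof -
    show "\<phi> s \<le> 1" "0 < \<phi> s"
      unfolding \<phi>_def W_def using k0 integral_gradient_sq_le[OF s] by simp_all
    show "exp (- gronwall_exponent M A \<mu>_lo E\<^sub>0) \<le> \<phi> s"
      unfolding \<phi>_def W_def gronwall_exponent_def k_def[symmetric]
      using mult_left_mono[OF integral_gradient_sq_le(2)[OF s] k0] by simp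
  qed
  have "Z t \<le> Z 0"
  proof (rule nonpos_derivative_le_initial[OF _ _ t])
    fix s assume s: "s \<in> {0..T}"
    show "(Z has_real_derivative (\<phi> s * - (k * gradient_sq s)) * (s * shifted_energy s)
        + (1 * shifted_energy s + D s * s) * \<phi> s + \<phi> s * (s * acceleration_sq s / 2) - src s) (at s within {0..T})"
    proof -
      have sh: "(shifted_energy has_real_derivative D s) (at s within {0..T})"
        unfolding shifted_energy_def[abs_def] D_def
        using DERIV_add[OF has_derivative_viscous_energy[OF s] DERIV_const] by simp
      show ?thesis
        unfolding Z_def[abs_def]
        by (intro DERIV_add DERIV_diff DERIV_mult \<phi> s sh DERIV_ident
            integral_has_real_derivative continuous_on_mult c\<phi> cacc csrc)
    qed
    let ?V = "gradient_sq s" and ?F = "shifted_energy s" and ?R = "acceleration_sq s"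
    have V0: "0 \<le> ?V" and F0: "0 \<le> ?F" and s0: "0 \<le> s" "s \<le> T"
      using gradient_sq_nonneg[OF s] shifted_energy_nonneg[OF s] s by auto
    \<comment> \<open>The rate \<open>k\<close> is fixed by this identity: one factor
      \<open>?V\<close>, with coefficient \<open>\<mu>_lo / 4\<close>, is traded for the functional,
      so that the remainder becomes linear in it.\<close>
    have "A\<^sup>2 * M / (2 * \<mu>_lo\<^sup>2) * ?V\<^sup>2 = k * ?V * (\<mu>_lo / 4 * ?V)"
      unfolding k_def using lo_pos by (simp add: field_simps power2_eq_square power3_eq_cube)
    also have "\<dots> \<le> k * ?V * ?F"
      using k0 V0 gradient_sq_le_shifted_energy[OF s] by (intro mult_left_mono) auto
    finally have "D s \<le> - ?R / 2 + k * ?V * ?F + l * ?V"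
      using viscous_energy_deriv_le[OF s] unfolding D_def l_def by simp
    then have "s * D s \<le> s * (- ?R / 2 + k * ?V * ?F + l * ?V)"
      using s0(1) by (rule mult_left_mono)
    moreover have "s * (l * ?V) \<le> T * (l * ?V)"
      using s0(2) l0 V0 by (intro mult_right_mono) auto
    ultimately have *: "?F + s * D s + s * ?R / 2 - k * ?V * (s * ?F) \<le> src s"
      unfolding src_def by (simp add: algebra_simps)
    have src0: "0 \<le> src s"
      unfolding src_def using F0 V0 l0 T_pos by simp
    have "\<phi> s * (?F + s * D s + s * ?R / 2 - k * ?V * (s * ?F)) \<le> \<phi> s * src s"
      using * \<phi>1(2)[OF s] by (intro mult_left_mono) auto
    also have "\<dots> \<le> 1 * src s"
      using \<phi>1(1)[OF s] src0 by (intro mult_right_mono) auto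
    finally show "(\<phi> s * - (k * ?V)) * (s * ?F) + (1 * ?F + D s * s) * \<phi> s + \<phi> s * (s * ?R / 2) - src s \<le> 0"
      by (simp add: algebra_simps)
  qed
  then have Z: "\<phi> t * (t * shifted_energy t) + integral {0..t} (\<lambda>s. \<phi> s * (s * acceleration_sq s / 2))
      \<le> integral {0..t} src"
    unfolding Z_def by simp
  \<comment> \<open>A lower bound for \<phi> on the whole time interval, so that the factor can be
    divided out at the end.\<close>
  define q where "q = exp (- gronwall_exponent M A \<mu>_lo E\<^sub>0)"
  have sub: "{0..t} \<subseteq> {0..T}" using t by auto
  have "q * (t * shifted_energy t) \<le> \<phi> t * (t * shifted_energy t)"
    unfolding q_def using \<phi>1(3)[OF t] shifted_energy_nonneg[OF t] t by (intro mult_right_mono) auto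
  moreover have "integral {0..t} (\<lambda>s. q * (s * acceleration_sq s / 2))
      \<le> integral {0..t} (\<lambda>s. \<phi> s * (s * acceleration_sq s / 2))"
  proof (rule integral_le)
    show "q * (s * acceleration_sq s / 2) \<le> \<phi> s * (s * acceleration_sq s / 2)" if "s \<in> {0..t}" for s
      unfolding q_def using \<phi>1(3)[of s] acceleration_sq_nonneg[of s] that t by (intro mult_right_mono) auto
    show "(\<lambda>s. q * (s * acceleration_sq s / 2)) integrable_on {0..t}"
      "(\<lambda>s. \<phi> s * (s * acceleration_sq s / 2)) integrable_on {0..t}"
      by (intro integrable_continuous_interval continuous_on_mult continuous_on_const
          continuous_on_subset[OF c\<phi> sub] continuous_on_subset[OF cacc sub])+
  qed
  moreover have "integral {0..t} (\<lambda>s. q * (s * acceleration_sq s / 2)) = q * integral {0..t} (\<lambda>s. s * acceleration_sq s / 2)"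
    by simp
  ultimately have "q * (t * shifted_energy t + integral {0..t} (\<lambda>s. s * acceleration_sq s / 2)) \<le> integral {0..t} src"
    using Z by (simp add: distrib_left)
  also have "\<dots> \<le> source_bound P A B \<mu>_lo \<mu>_hi E\<^sub>0 T"
  proof -
    let ?a = "(\<mu>_hi + 1) / 2 + T * l" and ?b = "P\<^sup>2 / 2 + P\<^sup>2 / \<mu>_lo"
    have iV: "gradient_sq integrable_on {0..t}"
      by (rule integrable_continuous_interval[OF continuous_on_subset[OF continuous_gradient_sq sub]])
    have I: "((\<lambda>s. ?a * gradient_sq s + ?b) has_integral ?a * W t + t * ?b) {0..t}"
      unfolding W_def by (intro has_integral_add has_integral_mult_right integrable_integral iV
          has_integral_const_0) (use t in simp)
    have "integral {0..t} src \<le> ?a * W t + t * ?b"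
    proof (rule has_integral_le[OF _ I])
      show "(src has_integral integral {0..t} src) {0..t}"
        by (rule integrable_integral[OF integrable_continuous_interval[OF continuous_on_subset[OF csrc sub]]])
      show "src s \<le> ?a * gradient_sq s + ?b" if "s \<in> {0..t}" for s
        using shifted_energy_le[of s] that t unfolding src_def by (simp add: algebra_simps)
    qed
    also have "\<dots> \<le> ?a * (E\<^sub>0 / (2 * \<mu>_lo)) + T * ?b"
      using hi_pos l0 T_pos integral_gradient_sq_le(2)[OF t] t lo_pos unfolding W_def
      by (intro add_mono mult_left_mono) (auto intro!: mult_right_mono)
    finally show ?thesis
      unfolding source_bound_def l_def .
  qed
  finally have "exp (gronwall_exponent M A \<mu>_lo E\<^sub>0) *
      (q * (t * shifted_energy t + integral {0..t} (\<lambda>s. s * acceleration_sq s / 2))) \<le> C\<^sub>w"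
    unfolding weighted_bound_def by (intro mult_left_mono) auto
  then show ?thesis
    unfolding q_def by (simp only: mult.assoc[symmetric] exp_minus_inverse mult_1)
qed

lemma weighted_gradient_le:
  assumes t: "t \<in> {0..T}"
  shows "t * gradient_sq t \<le> 4 * C\<^sub>w / \<mu>_lo"
proof -
  have "0 \<le> integral {0..t} (\<lambda>s. s * acceleration_sq s / 2)"
    using t acceleration_sq_nonneg
    by (intro integral_nonneg integrable_continuous_interval continuous_intros
        continuous_on_subset[OF continuous_acceleration_sq]) auto
  then have "t * shifted_energy t \<le> C\<^sub>w"
    using weighted_estimate[OF t] by simp
  moreover have "t * (\<mu>_lo / 4 * gradient_sq t) \<le> t * shifted_energy t"
    using gradient_sq_le_shifted_energy[OF t] t by (intro mult_left_mono) auto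
  ultimately show ?thesis
    using lo_pos by (simp add: field_simps)
qed

lemma weighted_acceleration_le: "integral {0..T} (\<lambda>s. s * acceleration_sq s) \<le> 2 * C\<^sub>w"
proof -
  have T: "T \<in> {0..T}" using T_pos by simp
  have "0 \<le> T * shifted_energy T"
    using shifted_energy_nonneg[OF T] T_pos by simp
  then show ?thesis
    using weighted_estimate[OF T] by simp
qed

lemma gradient_bound_sq_le:
  assumes "t \<in> {0..T}"
  shows "(gradient_bound t)\<^sup>2 \<le> 2 * (M * acceleration_sq t + P\<^sup>2) / \<mu>_lo\<^sup>2"
proof -
  have "0 \<le> M * acceleration_sq t"
    using acceleration_sq_nonneg[OF assms] M_pos by simp
  then have "(sqrt (M * acceleration_sq t) + P)\<^sup>2 \<le> 2 * (M * acceleration_sq t + P\<^sup>2)"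
    using sum_squares_bound[of "sqrt (M * acceleration_sq t)" P] by (simp add: power2_sum)
  then show ?thesis
    unfolding gradient_bound_def power_divide by (rule divide_right_mono) simp
qed

end

section \<open>From pointwise bounds to extended-valued norms\<close>

lemma set_nn_integral_le_integral:
  fixes g :: "real \<Rightarrow> real"
  assumes "\<And>x. x \<in> S \<Longrightarrow> f x \<le> ennreal (g x)" "\<And>x. x \<in> S \<Longrightarrow> 0 \<le> g x" "(g has_integral c) S"
  shows "(\<integral>\<^sup>+x\<in>S. f x \<partial>lborel) \<le> ennreal c"
proof -
  \<comment> \<open>The nonnegative integral is monotone for arbitrary integrands, so the dependence
    of the norms on time only has to be bounded pointwise.\<close>
  have "(\<integral>\<^sup>+x\<in>S. f x \<partial>lborel) \<le> (\<integral>\<^sup>+x. ennreal (indicator S x * g x) \<partial>lborel)"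
    by (rule nn_integral_mono) (use assms(1) in \<open>auto simp: indicator_def\<close>)
  also have "\<dots> = ennreal c"
    by (rule nn_integral_has_integral_lebesgue[OF assms(2,3)])
  finally show ?thesis .
qed

lemma L2_norm_sq_le:
  fixes f g :: "real \<Rightarrow> real"
  assumes le: "\<And>x. x \<in> \<Omega> \<Longrightarrow> (f x)\<^sup>2 \<le> g x" and g: "continuous_on {0..1} g"
  shows "(L2_norm f)\<^sup>2 \<le> ennreal (integral {0..1} g)"
proof -
  define I where "I = (\<integral>\<^sup>+x\<in>\<Omega>. ennreal ((f x)\<^sup>2) \<partial>lborel)"
  have "(g has_integral integral {0..1} g) \<Omega>"
    using integrable_integral[OF integrable_continuous_interval[OF g]]
    by (simp add: has_integral_Icc_iff_Ioo)
  then have I: "I \<le> ennreal (integral {0..1} g)"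
    unfolding I_def
    by (intro set_nn_integral_le_integral[where g=g] ennreal_leI le order_trans[OF zero_le_power2 le])
  \<comment> \<open>Finiteness selects the square-root branch of \<open>L2_norm\<close>, where
    squaring returns \<open>I\<close>.\<close>
  then have "I \<noteq> \<infinity>"
    using le_less_trans[OF I ennreal_less_top] by auto
  then have "(L2_norm f)\<^sup>2 = I"
    unfolding L2_norm_def I_def[symmetric] Let_def
    by (simp add: ennreal_power ennreal_enn2real less_top)
  then show ?thesis using I by simp
qed

lemma Linf_norm_sq_le:
  fixes f :: "real \<Rightarrow> real"
  assumes "continuous_on {0..1} f" "\<And>x. x \<in> \<Omega> \<Longrightarrow> \<bar>f x\<bar> \<le> c" "0 \<le> c"
  shows "(Linf_norm f)\<^sup>2 \<le> ennreal (c\<^sup>2)"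
proof -
  \<comment> \<open>Measurability has to come first, since the essential supremum of a nonmeasurable
    function is the top element by convention.\<close>
  have "continuous_on \<Omega> (\<lambda>x. \<bar>f x\<bar>)"
    by (intro continuous_intros continuous_on_subset[OF assms(1)]) auto
  then have "(\<lambda>x. \<bar>f x\<bar>) \<in> borel_measurable (restrict_space lborel \<Omega>)"
    using borel_measurable_continuous_on_restrict
    by (metis (no_types, lifting) measurable_cong_sets sets_lborel sets_restrict_space_cong)
  then have "(\<lambda>x. ennreal \<bar>f x\<bar>) \<in> borel_measurable (restrict_space lborel \<Omega>)"
    by measurable
  moreover have "AE x in restrict_space lborel \<Omega>. ennreal \<bar>f x\<bar> \<le> ennreal c"
    using assms(2) by (intro AE_I2) (auto simp: space_restrict_space intro: ennreal_leI)
  ultimately have "Linf_norm f \<le> ennreal c"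
    unfolding Linf_norm_def by (rule esssup_I)
  then have "(Linf_norm f)\<^sup>2 \<le> (ennreal c)\<^sup>2"
    by (rule power_mono) simp
  then show ?thesis
    using assms(3) by (simp add: ennreal_power)
qed

text \<open>The first summand bounds the supremum in time. In the factor
  \<open>2 * M / \<mu>\<^sub>l\<^sup>2 + 1 + M\<close> the terms belong to the sup norm of the
  gradient, the acceleration and the flux derivative; the last summand is the pressure part of the
  sup norm.\<close>

definition final_bound :: "real \<Rightarrow> real \<Rightarrow> real \<Rightarrow> real \<Rightarrow> real \<Rightarrow> real \<Rightarrow> real \<Rightarrow> real \<Rightarrow> real" where
  "final_bound M P A B \<mu>\<^sub>l \<mu>\<^sub>h E T =
    4 * weighted_bound M P A B \<mu>\<^sub>l \<mu>\<^sub>h E T / \<mu>\<^sub>l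
    + ((2 * M / \<mu>\<^sub>l\<^sup>2 + 1 + M) * (2 * weighted_bound M P A B \<mu>\<^sub>l \<mu>\<^sub>h E T) + T * (2 * T * P\<^sup>2 / \<mu>\<^sub>l\<^sup>2))"

section \<open>The estimate in the norms of the theorem\<close>

context bounded_viscous_flow
begin

lemma regularity_estimate:
  "(SUP t\<in>{0..T}. (L2_norm (\<lambda>x. sqrt t * u\<^sub>x t x))\<^sup>2)
    + (\<integral>\<^sup>+t\<in>{0..T}. ((Linf_norm (\<lambda>x. sqrt t * u\<^sub>x t x))\<^sup>2
          + (L2_norm (\<lambda>x. sqrt (\<rho> t x * t) * material_deriv T u t x))\<^sup>2
          + (L2_norm (\<lambda>x. sqrt t * Dx G t x))\<^sup>2) \<partial>lborel)
    \<le> ennreal (final_bound M P A B \<mu>_lo \<mu>_hi E\<^sub>0 T)"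
proof -
  let ?a = "2 * M / \<mu>_lo\<^sup>2 + 1 + M" and ?b = "2 * T * P\<^sup>2 / \<mu>_lo\<^sup>2"
  let ?c1 = "4 * C\<^sub>w / \<mu>_lo" and ?c2 = "?a * (2 * C\<^sub>w) + T * ?b"
  have sup: "(SUP t\<in>{0..T}. (L2_norm (\<lambda>x. sqrt t * u\<^sub>x t x))\<^sup>2) \<le> ennreal ?c1"
  proof (rule SUP_least)
    fix t assume t: "t \<in> {0..T}"
    have "(L2_norm (\<lambda>x. sqrt t * u\<^sub>x t x))\<^sup>2 \<le> ennreal (integral {0..1} (\<lambda>x. t * (u\<^sub>x t x)\<^sup>2))"
      by (rule L2_norm_sq_le) (use t in \<open>auto simp: power_mult_distrib
          intro!: continuous_intros continuous_on_slice[OF _ t] continuous_fields\<close>)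
    also have "\<dots> \<le> ennreal ?c1"
      using weighted_gradient_le[OF t] unfolding gradient_sq_def by (intro ennreal_leI) simp
    finally show "(L2_norm (\<lambda>x. sqrt t * u\<^sub>x t x))\<^sup>2 \<le> ennreal ?c1" .
  qed
  have "(\<integral>\<^sup>+t\<in>{0..T}. ((Linf_norm (\<lambda>x. sqrt t * u\<^sub>x t x))\<^sup>2
          + (L2_norm (\<lambda>x. sqrt (\<rho> t x * t) * material_deriv T u t x))\<^sup>2
          + (L2_norm (\<lambda>x. sqrt t * Dx G t x))\<^sup>2) \<partial>lborel)
      \<le> ennreal (?a * integral {0..T} (\<lambda>t. t * acceleration_sq t) + T * ?b)"
  proof (rule set_nn_integral_le_integral)
    show "((\<lambda>t. ?a * (t * acceleration_sq t) + ?b) has_integral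
        (?a * integral {0..T} (\<lambda>t. t * acceleration_sq t) + T * ?b)) {0..T}"
      by (intro has_integral_add has_integral_mult_right has_integral_const_0 integrable_integral
          integrable_continuous_interval continuous_intros continuous_acceleration_sq) (use T_pos in simp)
    fix t assume t: "t \<in> {0..T}"
    let ?R = "acceleration_sq t"
    have tR: "0 \<le> t * ?R" using acceleration_sq_nonneg[OF t] t by simp
    have a0: "0 \<le> ?a" "0 \<le> ?b" using M_pos T_pos by simp_all
    show "0 \<le> ?a * (t * ?R) + ?b"
      by (intro add_nonneg_nonneg mult_nonneg_nonneg a0 tR)
    have linf: "(Linf_norm (\<lambda>x. sqrt t * u\<^sub>x t x))\<^sup>2 \<le> ennreal ((sqrt t * gradient_bound t)\<^sup>2)"
      using t by (intro Linf_norm_sq_le continuous_intros continuous_on_slice[OF _ t] continuous_fields)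
        (auto simp: abs_mult intro!: mult_left_mono gradient_le gradient_bound_nonneg mult_nonneg_nonneg)
    have acc: "(L2_norm (\<lambda>x. sqrt (\<rho> t x * t) * material_deriv T u t x))\<^sup>2 \<le> ennreal (t * ?R)"
    proof -
      have "(L2_norm (\<lambda>x. sqrt (\<rho> t x * t) * material_deriv T u t x))\<^sup>2
          \<le> ennreal (integral {0..1} (\<lambda>x. t * (\<rho> t x * (material_deriv T u t x)\<^sup>2)))"
      proof (rule L2_norm_sq_le)
        show "(sqrt (\<rho> t x * t) * material_deriv T u t x)\<^sup>2 \<le> t * (\<rho> t x * (material_deriv T u t x)\<^sup>2)"
          if "x \<in> \<Omega>" for x
          using density_pos[OF t that] t by (simp add: power_mult_distrib)
      qed (intro continuous_intros continuous_on_slice[OF _ t] continuous_fields continuous_material_deriv)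
      then show ?thesis unfolding acceleration_sq_def by simp
    qed
    have flx: "(L2_norm (\<lambda>x. sqrt t * Dx G t x))\<^sup>2 \<le> ennreal (t * M * ?R)"
    proof -
      have "(L2_norm (\<lambda>x. sqrt t * Dx G t x))\<^sup>2
          \<le> ennreal (integral {0..1} (\<lambda>x. t * M * (\<rho> t x * (material_deriv T u t x)\<^sup>2)))"
      proof (rule L2_norm_sq_le)
        fix x assume "x \<in> \<Omega>"
        then have x: "x \<in> {0..1}" by auto
        have "t * (G\<^sub>x t x)\<^sup>2 \<le> t * (M * (\<rho> t x * (material_deriv T u t x)\<^sup>2))"
          using flux_deriv_sq_le[OF t x] t by (intro mult_left_mono) auto
        then show "(sqrt t * Dx G t x)\<^sup>2 \<le> t * M * (\<rho> t x * (material_deriv T u t x)\<^sup>2)"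
          using t unfolding Dx_eqI[of G, OF flux_has_Dx[OF t x] x] by (simp add: power_mult_distrib mult.assoc)
      qed (intro continuous_intros continuous_on_slice[OF _ t] continuous_fields continuous_material_deriv)
      then show ?thesis unfolding acceleration_sq_def by simp
    qed
    have "(sqrt t * gradient_bound t)\<^sup>2 + t * ?R + t * M * ?R \<le> ?a * (t * ?R) + ?b"
    proof -
      have "(sqrt t * gradient_bound t)\<^sup>2 = t * (gradient_bound t)\<^sup>2"
        using t by (simp add: power_mult_distrib)
      also have "\<dots> \<le> t * (2 * (M * ?R + P\<^sup>2) / \<mu>_lo\<^sup>2)"
        using gradient_bound_sq_le[OF t] t by (intro mult_left_mono) auto
      also have "\<dots> = 2 * M / \<mu>_lo\<^sup>2 * (t * ?R) + 2 * t * P\<^sup>2 / \<mu>_lo\<^sup>2"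
        by (simp add: field_simps add_divide_distrib)
      also have "2 * t * P\<^sup>2 / \<mu>_lo\<^sup>2 \<le> ?b"
        using t by (intro divide_right_mono mult_right_mono) auto
      finally show ?thesis by (simp add: algebra_simps)
    qed
    moreover have "0 \<le> t * M * ?R" using acceleration_sq_nonneg[OF t] M_pos t by simp
    ultimately show "(Linf_norm (\<lambda>x. sqrt t * u\<^sub>x t x))\<^sup>2
          + (L2_norm (\<lambda>x. sqrt (\<rho> t x * t) * material_deriv T u t x))\<^sup>2
          + (L2_norm (\<lambda>x. sqrt t * Dx G t x))\<^sup>2 \<le> ennreal (?a * (t * ?R) + ?b)"
      using add_mono[OF add_mono[OF linf acc] flx] tR
      by (simp add: ennreal_plus[symmetric] del: ennreal_plus) (meson ennreal_leI order_trans)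
  qed
  also have "\<dots> \<le> ennreal ?c2"
    using weighted_acceleration_le M_pos T_pos by (intro ennreal_leI add_mono mult_left_mono) auto
  finally have int: "(\<integral>\<^sup>+t\<in>{0..T}. ((Linf_norm (\<lambda>x. sqrt t * u\<^sub>x t x))\<^sup>2
          + (L2_norm (\<lambda>x. sqrt (\<rho> t x * t) * material_deriv T u t x))\<^sup>2
          + (L2_norm (\<lambda>x. sqrt t * Dx G t x))\<^sup>2) \<partial>lborel) \<le> ennreal ?c2" .
  have T: "T \<in> {0..T}" using T_pos by simp
  have C0: "0 \<le> C\<^sub>w"
    using weighted_estimate[of 0] T_pos by simp
  have "0 \<le> ?c1" "0 \<le> ?c2"
    using C0 lo_pos M_pos T_pos by simp_all
  then show ?thesis
    using add_mono[OF sup int] unfolding final_bound_def by (simp add: ennreal_plus[symmetric] del: ennreal_plus)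
qed

end

section \<open>Constants independent of the solution\<close>

lemma coefficients_bounded:
  assumes p: "pressure_law p" and \<mu>: "C1_nonneg \<mu>"
  obtains P A B where "\<And>r. 0 \<le> r \<Longrightarrow> r \<le> M \<Longrightarrow> p r \<le> P"
    "\<And>r. 0 \<le> r \<Longrightarrow> r \<le> M \<Longrightarrow> \<bar>(\<mu> r + r * deriv_nonneg \<mu> r) / 2\<bar> \<le> A"
    "\<And>r. 0 \<le> r \<Longrightarrow> r \<le> M \<Longrightarrow> r * deriv_nonneg p r \<le> B"
proof -
  \<comment> \<open>Continuity up to \<open>r = 0\<close> gives compactness on \<open>[0,M]\<close>;
    this is where the independence from a lower density bound is secured for the
    coefficients.\<close>
  have bdd: "\<exists>c. \<forall>r\<in>{0..M}. \<bar>f r\<bar> \<le> c" if "continuous_on {0..} f" for f :: "real \<Rightarrow> real"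
  proof -
    have "compact (f ` {0..M})"
      by (intro compact_continuous_image continuous_on_subset[OF that]) auto
    then show ?thesis
      using compact_imp_bounded[of "f ` {0..M}"] unfolding bounded_iff by auto
  qed
  have c: "continuous_on {0..} p" "continuous_on {0..} (deriv_nonneg p)"
      "continuous_on {0..} \<mu>" "continuous_on {0..} (deriv_nonneg \<mu>)"
    using p \<mu> C1_nonneg_continuous unfolding pressure_law_def C1_nonneg_def by auto
  obtain P where P: "\<forall>r\<in>{0..M}. \<bar>p r\<bar> \<le> P"
    using bdd[OF c(1)] by blast
  have "continuous_on {0..} (\<lambda>r. (\<mu> r + r * deriv_nonneg \<mu> r) / 2)"
    by (intro continuous_intros c) simp
  from bdd[OF this] obtain A where A: "\<forall>r\<in>{0..M}. \<bar>(\<mu> r + r * deriv_nonneg \<mu> r) / 2\<bar> \<le> A"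
    by blast
  have "continuous_on {0..} (\<lambda>r. r * deriv_nonneg p r)"
    by (intro continuous_intros c)
  from bdd[OF this] obtain B where B: "\<forall>r\<in>{0..M}. \<bar>r * deriv_nonneg p r\<bar> \<le> B"
    by blast
  show ?thesis
    by (rule that[of P A B]) (use P A B in \<open>force simp: abs_le_iff\<close>)+
qed

theorem lemma2p4:
  fixes p \<mu> :: "real \<Rightarrow> real"
  assumes "pressure_law p" and "viscosity_law \<mu>"
  shows "\<exists>C :: real \<Rightarrow> real \<Rightarrow> real \<Rightarrow> real \<Rightarrow> real \<Rightarrow> real.
    \<forall>(\<mu>_lo :: real) (\<mu>_hi :: real) (\<rho>_hi :: real) (T :: real)
      (\<rho>\<^sub>0 :: real \<Rightarrow> real) (u\<^sub>0 :: real \<Rightarrow> real)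
      (\<rho> :: real \<Rightarrow> real \<Rightarrow> real) (u :: real \<Rightarrow> real \<Rightarrow> real).
      0 < \<mu>_lo \<longrightarrow> 0 < \<mu>_hi \<longrightarrow> (\<forall>s\<ge>0. \<mu>_lo \<le> \<mu> s \<and> \<mu> s \<le> \<mu>_hi) \<longrightarrow>
      0 < \<rho>_hi \<longrightarrow> (\<forall>x\<in>\<Omega>. \<rho>\<^sub>0 x \<le> \<rho>_hi) \<longrightarrow>
      (LINT x:\<Omega>|lborel. \<rho>\<^sub>0 x) = 1 \<longrightarrow> (LINT x:\<Omega>|lborel. \<rho>\<^sub>0 x * u\<^sub>0 x) = 0 \<longrightarrow>
      0 < T \<longrightarrow>
      smooth_solution p \<mu> T \<rho>\<^sub>0 u\<^sub>0 \<rho> u \<longrightarrow>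
      (\<forall>t\<in>{0..T}. \<forall>x\<in>\<Omega>. 0 < \<rho> t x) \<longrightarrow>
      (SUP t\<in>{0..T}. (L2_norm (\<lambda>x. sqrt t * Dx u t x))\<^sup>2)
        + (\<integral>\<^sup>+t\<in>{0..T}.
             ((Linf_norm (\<lambda>x. sqrt t * Dx u t x))\<^sup>2
              + (L2_norm (\<lambda>x. sqrt (\<rho> t x * t) * material_deriv T u t x))\<^sup>2
              + (L2_norm (\<lambda>x. sqrt t * Dx (flux p \<mu> \<rho> u) t x))\<^sup>2) \<partial>lborel)
      \<le> ennreal (C (energy p \<rho>\<^sub>0 u\<^sub>0) \<rho>_hi \<mu>_lo \<mu>_hi T)"
proof -
  have C1: "C1_nonneg \<mu>"
    using assms(2) unfolding viscosity_law_def by blast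
  have "\<exists>P A B. \<forall>r. 0 \<le> r \<and> r \<le> M \<longrightarrow> p r \<le> P
      \<and> \<bar>(\<mu> r + r * deriv_nonneg \<mu> r) / 2\<bar> \<le> A \<and> r * deriv_nonneg p r \<le> B" for M
    by (rule coefficients_bounded[OF assms(1) C1, of M]) blast
  \<comment> \<open>The bounds become functions of \<open>M\<close> alone, chosen before any
    solution is introduced, so that a single \<open>C\<close> serves all solutions.\<close>
  then obtain P A B :: "real \<Rightarrow> real" where PAB: "\<And>M r. 0 \<le> r \<Longrightarrow> r \<le> M \<Longrightarrow> p r \<le> P M
      \<and> \<bar>(\<mu> r + r * deriv_nonneg \<mu> r) / 2\<bar> \<le> A M \<and> r * deriv_nonneg p r \<le> B M"
    by metis
  \<comment> \<open>This is \<open>density_bound\<close> with its ingredients turned into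
    arguments.\<close>
  define M where "M E rh lo hi = exp ((hi * ln (max rh 1) + (1 + E)) / lo)" for E rh lo hi :: real
  define C where "C E rh lo hi T = final_bound (M E rh lo hi) (P (M E rh lo hi)) (A (M E rh lo hi))
      (B (M E rh lo hi)) lo hi E T" for E rh lo hi T
  show ?thesis
  proof (intro exI[of _ C] allI impI)
    fix \<mu>_lo \<mu>_hi \<rho>_hi T :: real and \<rho>\<^sub>0 u\<^sub>0 :: "real \<Rightarrow> real" and \<rho> u :: "real \<Rightarrow> real \<Rightarrow> real"
    assume *: "0 < \<mu>_lo" "0 < \<mu>_hi" "\<forall>s\<ge>0. \<mu>_lo \<le> \<mu> s \<and> \<mu> s \<le> \<mu>_hi" "0 < \<rho>_hi" "\<forall>x\<in>\<Omega>. \<rho>\<^sub>0 x \<le> \<rho>_hi"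
      "(LINT x:\<Omega>|lborel. \<rho>\<^sub>0 x) = 1" "0 < T" "smooth_solution p \<mu> T \<rho>\<^sub>0 u\<^sub>0 \<rho> u"
      "\<forall>t\<in>{0..T}. \<forall>x\<in>\<Omega>. 0 < \<rho> t x"
    interpret viscous_flow p \<mu> T \<mu>_lo \<mu>_hi \<rho>_hi \<rho>\<^sub>0 u\<^sub>0 \<rho> u
      using * assms(1) C1 by unfold_locales auto
    let ?M = "M E\<^sub>0 \<rho>_hi \<mu>_lo \<mu>_hi"
    interpret bounded_viscous_flow p \<mu> T \<mu>_lo \<mu>_hi \<rho>_hi \<rho>\<^sub>0 u\<^sub>0 \<rho> u ?M "P ?M" "A ?M" "B ?M"
    proof unfold_locales
      show "\<rho> t x \<le> ?M" if "t \<in> {0..T}" "x \<in> {0..1}" for t x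
        using density_le[OF that] unfolding density_bound_def M_def .
      show "0 < ?M"
        unfolding M_def by simp
    qed (use PAB in auto)
    show "(SUP t\<in>{0..T}. (L2_norm (\<lambda>x. sqrt t * Dx u t x))\<^sup>2)
        + (\<integral>\<^sup>+t\<in>{0..T}.
             ((Linf_norm (\<lambda>x. sqrt t * Dx u t x))\<^sup>2
              + (L2_norm (\<lambda>x. sqrt (\<rho> t x * t) * material_deriv T u t x))\<^sup>2
              + (L2_norm (\<lambda>x. sqrt t * Dx (flux p \<mu> \<rho> u) t x))\<^sup>2) \<partial>lborel)
      \<le> ennreal (C (energy p \<rho>\<^sub>0 u\<^sub>0) \<rho>_hi \<mu>_lo \<mu>_hi T)"
      unfolding C_def by (rule regularity_estimate)
  qed
qed

end
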